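(* Let $n \geq 3$ be an integer. The generating function $G_n(x) := \sum_{d=1}^{n-2} N_{n,d}\, x^d$ has the expansion $$ G_n(x)=(1-x)^n \sum_{i \geq 1} \Delta_n(i) \, x^i , $$ as an equality between formal power series in $x$.
   Context: $\mathscr{S}_n$ is the group of all permutations of $\{1,\ldots,n\}$ and $\mathscr{C}_n \subset \mathscr{S}_n$ is the set of all $n$-cycles. For $\nu \in \mathscr{S}_n$ the degree is $\deg(\nu) = \#\{ i : \nu(i) > \nu(i+1)\}$, where $i$ ranges over $\{1,\ldots,n\}$ taken modulo $n$, so that $i=n$ is counted exactly when $\nu(n)>\nu(1)$. $N_{n,d}$ denotes the number of $\nu \in \mathscr{C}_n$ with $\deg(\nu)=d$. For integers $i\geq 1$, $\Delta_n(i) = \sum_{r|n} \mu(n/r) \big(\sum_{j=0}^{r-1} i^j \big)$, where the sum is over positive divisors $r$ of $n$ and $\mu$ is the Möbius function. *)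

theory Defs
  imports
    "HOL-Combinatorics.Orbits"
    "HOL-Computational_Algebra.Squarefree"
    "HOL-Computational_Algebra.Formal_Power_Series"
begin

text \<open>
  Elements of the symmetric group are functions on \<^typ>\<open>nat\<close> that permute \<open>{1..n}\<close> and are the
  identity elsewhere.
\<close>

definition n_cycles :: "nat \<Rightarrow> (nat \<Rightarrow> nat) set" where
  "n_cycles n = {\<nu>. \<nu> permutes {1..n} \<and> cyclic_on \<nu> {1..n}}"

text \<open>On \<open>{1..n}\<close>, the cyclic successor of \<open>i\<close> is \<open>i mod n + 1\<close>; in particular it sends \<open>n\<close> to \<open>1\<close>.\<close>

definition perm_deg :: "nat \<Rightarrow> (nat \<Rightarrow> nat) \<Rightarrow> nat" where
  "perm_deg n \<nu> = card {i \<in> {1..n}. \<nu> i > \<nu> (i mod n + 1)}"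

definition num_cycles_deg :: "nat \<Rightarrow> nat \<Rightarrow> nat" where
  "num_cycles_deg n d = card {\<nu> \<in> n_cycles n. perm_deg n \<nu> = d}"

definition moebius_mu :: "nat \<Rightarrow> int" where
  "moebius_mu m = (if squarefree m then (-1) ^ card (prime_factors m) else 0)"

definition Delta :: "nat \<Rightarrow> nat \<Rightarrow> int" where
  "Delta n i = (\<Sum>r | r dvd n. moebius_mu (n div r) * (\<Sum>j<r. int i ^ j))"

definition deg_gen_fun :: "nat \<Rightarrow> int fps" where
  "deg_gen_fun n = (\<Sum>d=1..n-2. fps_const (int (num_cycles_deg n d)) * fps_X ^ d)"

end

theory Submission
  imports Defs "HOL-Library.Infinite_Set" "HOL-Computational_Algebra.Polynomial"
begin

text \<open>
  Since \<open>(1 - x) ^ n\<close> is inverted by the series with coefficients \<open>(n - 1 + k) choose (n - 1)\<close>, the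
  theorem amounts to the identity
  \<open>(\<Sum>\<nu>. (n - 1 + k - deg \<nu>) choose (n - 1)) = Delta n k\<close> for all \<open>k \<ge> 1\<close>, where \<open>\<nu>\<close> ranges over the
  \<open>n\<close>-cycles, together with the fact that the degree of an \<open>n\<close>-cycle lies between \<open>1\<close> and \<open>n - 2\<close>.
  Both sides of the identity are polynomials in \<open>k\<close>, so it is enough to treat \<open>k \<ge> 2\<close>
  (lemmas \<open>sum_binomial_perm_deg_eq_Delta_of_ge_2\<close> and \<open>sum_binomial_perm_deg_eq_Delta\<close>).

  For \<open>k \<ge> 2\<close> count the points of exact period \<open>n\<close> of the map \<open>x \<mapsto> k x\<close> modulo \<open>k ^ n - 1\<close> in two ways.
  For \<open>r\<close> dividing \<open>n\<close>, the \<open>r\<close>-th iterate has \<open>k ^ r - 1\<close> fixed points, so Moebius inversion gives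
  \<open>(k - 1) * Delta n k\<close> (\<open>card_exact_period_points_eq_Delta\<close>). On the other hand, list a periodic orbit in
  increasing order. The map permutes the positions by an \<open>n\<close>-cycle \<open>\<nu>\<close>, and the leading base-\<open>k\<close> digits
  of the points form a weakly increasing sequence that increases strictly at the descents of \<open>\<nu>\<close>.
  Conversely, \<open>\<nu>\<close> and such a sequence determine the base-\<open>k\<close> expansions of all points of the orbit. As
  there are \<open>(n + k - 1 - des \<nu>) choose n\<close> such sequences, the points number
  \<open>n * (\<Sum>\<nu>. (n + k - 1 - des \<nu>) choose n)\<close> (\<open>card_exact_period_points_eq_sum_labellings\<close>).

  It remains to pass from linear descents to the cyclic ones counted by the degree. Conjugation by the
  rotation of \<open>{1..n}\<close> preserves the degree \<open>d\<close>, and of the \<open>n\<close> conjugates of \<open>\<nu>\<close> exactly \<open>d - 1\<close> have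
  a descent from the last to the first position. Averaging over the conjugates turns the sum above
  into \<open>(k - 1) * (\<Sum>\<nu>. (n - 1 + k - deg \<nu>) choose (n - 1))\<close>
  (\<open>sum_binomial_descents_eq_sum_binomial_perm_deg\<close>), and the factor \<open>k - 1\<close> cancels.
\<close>

section \<open>Moebius inversion for points of exact period\<close>

lemma moebius_mu_prime_mult:
  assumes p: "prime p" and d: "\<not> p dvd d"
  shows "moebius_mu (p * d) = - moebius_mu d"
proof -
  have d0: "d \<noteq> 0" using d by (metis dvd_0_right)
  have p0: "p \<noteq> 0" using p by auto
  have cop: "coprime p d" using p d by (simp add: prime_imp_coprime)
  have sq: "squarefree (p * d) \<longleftrightarrow> squarefree d"
    using squarefree_mult_coprime[OF cop squarefree_prime[OF p]] squarefree_multD(2) by blast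
  have "prime_factors (p * d) = insert p (prime_factors d)"
    using d0 p0 p by (simp add: prime_factorization_mult prime_factorization_prime)
  moreover have "p \<notin> prime_factors d"
    using d by (auto simp: in_prime_factors_iff)
  ultimately have "card (prime_factors (p * d)) = Suc (card (prime_factors d))"
    by simp
  then show ?thesis using sq by (simp add: moebius_mu_def)
qed

text \<open>
  Fix a prime \<open>p\<close> dividing \<open>m\<close>. Multiplication by \<open>p\<close> matches the squarefree divisors of \<open>m\<close> that avoid
  \<open>p\<close> with those that contain it, and it flips the sign of \<open>\<mu>\<close>, so everything cancels.
\<close>

lemma sum_moebius_mu_divisors:
  assumes "m > 0"
  shows "(\<Sum>d | d dvd m. moebius_mu d) = (if m = 1 then 1 else 0)"
proof (cases "m = 1")
  case True
  have "{d. d dvd (1::nat)} = {1}" by auto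
  then show ?thesis using True by (simp add: moebius_mu_def)
next
  case False
  obtain p where p: "prime p" "p dvd m" using False by (metis prime_factor_nat)
  let ?A = "{d. d dvd m \<and> \<not> p dvd d \<and> squarefree d}"
  let ?B = "{d. d dvd m \<and> p dvd d \<and> squarefree d}"
  have fin: "finite {d. d dvd m}" using assms by simp
  have "?B = (*) p ` ?A"
  proof (intro set_eqI iffI)
    fix x assume x: "x \<in> ?B"
    then obtain d where d: "x = p * d" by auto
    have "\<not> p dvd d"
    proof
      assume "p dvd d"
      then have "p ^ 2 dvd x" using d by (simp add: power2_eq_square)
      then show False using x squarefreeD p(1) not_prime_unit by blast
    qed
    moreover have "d dvd m" using x d dvd_mult_right by blast
    moreover have "squarefree d" using x d squarefree_multD(2) by blast
    ultimately show "x \<in> (*) p ` ?A" using d by auto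
  next
    fix x assume "x \<in> (*) p ` ?A"
    then obtain d where d: "x = p * d" "d dvd m" "\<not> p dvd d" "squarefree d" by auto
    have cop: "coprime p d" using p d by (simp add: prime_imp_coprime)
    then have "p * d dvd m" using p d by (simp add: divides_mult)
    moreover have "squarefree (p * d)"
      using squarefree_mult_coprime[OF cop squarefree_prime[OF p(1)]] d by blast
    ultimately show "x \<in> ?B" using d by auto
  qed
  moreover have "inj_on ((*) p) ?A" using p by (intro inj_onI) auto
  ultimately have B: "sum moebius_mu ?B = (\<Sum>d\<in>?A. - moebius_mu d)"
    by (simp add: sum.reindex moebius_mu_prime_mult[OF p(1)])
  have "(\<Sum>d | d dvd m. moebius_mu d) = sum moebius_mu (?A \<union> ?B)"
    using fin by (intro sum.mono_neutral_right) (auto simp: moebius_mu_def)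
  also have "\<dots> = sum moebius_mu ?A + sum moebius_mu ?B"
    using fin by (intro sum.union_disjoint) (auto intro: finite_subset[OF _ fin])
  also have "\<dots> = 0" using B by (simp add: sum_negf)
  finally show ?thesis using False by simp
qed

text \<open>
  Moebius inversion carried out pointwise: \<open>x\<close> is fixed by the \<open>r\<close>-th iterate exactly when its least
  period \<open>p\<close> divides \<open>r\<close>, so \<open>x\<close> contributes to the right-hand side the sum of \<open>\<mu> (n div r)\<close> over
  \<open>p dvd r dvd n\<close>, which is a full divisor sum of \<open>\<mu>\<close> for \<open>n div p\<close>.
\<close>

lemma card_exact_period_eq_moebius_sum:
  fixes T :: "'a \<Rightarrow> 'a"
  assumes X: "finite X" and n: "n > 0" and per: "\<And>x. x \<in> X \<Longrightarrow> (T ^^ n) x = x"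
  shows "int (card {x \<in> X. \<forall>r. 0 < r \<and> r < n \<longrightarrow> (T ^^ r) x \<noteq> x}) =
    (\<Sum>r | r dvd n. moebius_mu (n div r) * int (card {x \<in> X. (T ^^ r) x = x}))"
proof -
  have inner: "(\<Sum>r | r dvd n. moebius_mu (n div r) * of_bool ((T ^^ r) x = x)) =
      (of_bool (\<forall>r. 0 < r \<and> r < n \<longrightarrow> (T ^^ r) x \<noteq> x) :: int)" if x: "x \<in> X" for x
  proof -
    define p where "p = (LEAST r. 0 < r \<and> (T ^^ r) x = x)"
    have p: "0 < p" "(T ^^ p) x = x"
      using LeastI[of "\<lambda>r. 0 < r \<and> (T ^^ r) x = x" n] n per[OF x] by (auto simp: p_def)
    have least: "p \<le> r" if "0 < r" "(T ^^ r) x = x" for r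
      unfolding p_def using that by (intro Least_le) auto
    have dvd: "(T ^^ r) x = x \<longleftrightarrow> p dvd r" for r
    proof -
      have "(T ^^ r) x = (T ^^ (r mod p)) x" using p(2) by (simp add: funpow_mod_eq)
      moreover have "(T ^^ (r mod p)) x = x \<longleftrightarrow> r mod p = 0"
        using least[of "r mod p"] p(1) mod_less_divisor[OF p(1), of r]
        by (metis funpow_0 gr0I not_le)
      ultimately show ?thesis by (simp add: dvd_eq_mod_eq_0)
    qed
    have pn: "p dvd n" using dvd per[OF x] by blast
    have "(\<Sum>r | r dvd n. moebius_mu (n div r) * of_bool ((T ^^ r) x = x)) =
        (\<Sum>r | r dvd n \<and> p dvd r. moebius_mu (n div r))"
      using n by (intro sum.mono_neutral_cong_right) (auto simp: dvd)
    also have "\<dots> = (\<Sum>d | d dvd n div p. moebius_mu d)"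
    proof (rule sum.reindex_bij_witness[of _ "\<lambda>d. n div d" "\<lambda>r. n div r"])
      fix r assume "r \<in> {r. r dvd n \<and> p dvd r}"
      then obtain c e where r: "r = p * c" "n = r * e" by (metis dvdE mem_Collect_eq)
      then have "r \<noteq> 0" "e \<noteq> 0" using n by auto
      then have "n div r = e" "n div e = r" "n div p = c * e" using r p by auto
      then show "n div (n div r) = r" "n div r \<in> {d. d dvd n div p}" by auto
    next
      fix d assume "d \<in> {d. d dvd n div p}"
      then obtain e where e: "n div p = d * e" by auto
      then have "n = p * d * e" using pn by (metis dvd_mult_div_cancel mult.assoc)
      moreover from this have "d \<noteq> 0" "e \<noteq> 0" using n by auto
      ultimately have "n div d = p * e" "n div (p * e) = d" using p n by auto
      then show "n div (n div d) = d" "n div d \<in> {r. r dvd n \<and> p dvd r}"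
        using \<open>n = p * d * e\<close> by auto
    qed auto
    also have "\<dots> = of_bool (n div p = 1)"
      using pn n p by (subst sum_moebius_mu_divisors) (auto simp: dvd_imp_le div_greater_zero_iff)
    also have "n div p = 1 \<longleftrightarrow> p = n"
      using pn n p(1) by (metis div_self dvd_mult_div_cancel less_not_refl2 mult.right_neutral)
    also have "p = n \<longleftrightarrow> (\<forall>r. 0 < r \<and> r < n \<longrightarrow> (T ^^ r) x \<noteq> x)"
      using least p dvd_imp_le[OF pn n] by (metis le_neq_implies_less not_le)
    finally show ?thesis .
  qed
  have "int (card {x \<in> X. \<forall>r. 0 < r \<and> r < n \<longrightarrow> (T ^^ r) x \<noteq> x}) =
      (\<Sum>x\<in>X. of_bool (\<forall>r. 0 < r \<and> r < n \<longrightarrow> (T ^^ r) x \<noteq> x))"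
    using X by (simp add: of_bool_def sum.If_cases Int_def)
  also have "\<dots> = (\<Sum>x\<in>X. \<Sum>r | r dvd n. moebius_mu (n div r) * of_bool ((T ^^ r) x = x))"
    using inner by simp
  also have "\<dots> = (\<Sum>r | r dvd n. \<Sum>x\<in>X. moebius_mu (n div r) * of_bool ((T ^^ r) x = x))"
    by (rule sum.swap)
  also have "\<dots> = (\<Sum>r | r dvd n. moebius_mu (n div r) * int (card {x \<in> X. (T ^^ r) x = x}))"
    using X by (simp add: sum_distrib_left[symmetric] of_bool_def sum.If_cases Int_def)
  finally show ?thesis .
qed

section \<open>Increasing sequences with prescribed strict steps\<close>

text \<open>
  For an \<open>n\<close>-cycle with descent set \<open>D\<close>, these are the possible sequences of leading base-\<open>k\<close> digits of
  a periodic orbit listed in increasing order.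
\<close>

definition labellings :: "nat \<Rightarrow> nat \<Rightarrow> nat set \<Rightarrow> (nat \<Rightarrow> nat) set" where
  "labellings n k D = {f \<in> {1..n} \<rightarrow>\<^sub>E {..<k}.
     \<forall>i\<in>{1..<n}. f i \<le> f (Suc i) \<and> (i \<in> D \<longrightarrow> f i < f (Suc i))}"

lemma finite_labellings: "finite (labellings n k D)"
  unfolding labellings_def by (rule finite_subset[of _ "{1..n} \<rightarrow>\<^sub>E {..<k}"]) (auto intro: finite_PiE)

text \<open>
  Split by whether the last value is the largest admissible one. If it is, then a strict step at \<open>n\<close>
  lowers the bound for the remaining values by one.
\<close>

lemma labellings_Suc_Suc:
  "labellings (Suc n) (Suc k) D = labellings (Suc n) k D \<union>
    (\<lambda>f. f(Suc n := k)) ` labellings n (if n \<in> D then k else Suc k) D" if "n > 0 \<or> n \<notin> D"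
proof (intro set_eqI iffI)
  fix f assume f: "f \<in> labellings (Suc n) (Suc k) D"
  have mono: "f i \<le> f j" if "1 \<le> i" "i \<le> j" "j \<le> Suc n" for i j
    using that(2,1,3)
  proof (induction rule: dec_induct)
    case (step m)
    moreover from step have "f m \<le> f (Suc m)" using f by (auto simp: labellings_def)
    ultimately show ?case by simp
  qed simp
  show "f \<in> labellings (Suc n) k D \<union>
    (\<lambda>f. f(Suc n := k)) ` labellings n (if n \<in> D then k else Suc k) D"
  proof (cases "f (Suc n) = k")
    case False
    have "f (Suc n) < Suc k" using f by (auto simp: labellings_def PiE_iff)
    then have "f i < k" if "i \<in> {1..Suc n}" for i
      using mono[of i "Suc n"] that False by auto
    then have "f \<in> labellings (Suc n) k D"
      using f by (auto simp: labellings_def PiE_iff)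
    then show ?thesis by blast
  next
    case True
    let ?g = "f(Suc n := undefined)"
    have less: "f i < k" if "i \<in> {1..n}" "n \<in> D" for i
    proof -
      have "f n < f (Suc n)" using f that by (auto simp: labellings_def)
      then show ?thesis using mono[of i n] that True by auto
    qed
    have "?g \<in> labellings n (if n \<in> D then k else Suc k) D"
      using f less by (auto simp: labellings_def PiE_iff extensional_def)
    moreover have "f = ?g(Suc n := k)" using True by auto
    ultimately show ?thesis by blast
  qed
next
  fix f assume "f \<in> labellings (Suc n) k D \<union>
    (\<lambda>f. f(Suc n := k)) ` labellings n (if n \<in> D then k else Suc k) D"
  then show "f \<in> labellings (Suc n) (Suc k) D"
  proof
    assume "f \<in> labellings (Suc n) k D"
    then show ?thesis by (auto simp: labellings_def PiE_iff less_Suc_eq)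
  next
    assume "f \<in> (\<lambda>f. f(Suc n := k)) ` labellings n (if n \<in> D then k else Suc k) D"
    then obtain g where g: "f = g(Suc n := k)" "g \<in> labellings n (if n \<in> D then k else Suc k) D"
      by auto
    have range: "g i < (if n \<in> D then k else Suc k)" if "i \<in> {1..n}" for i
      using g(2) that by (auto simp: labellings_def PiE_iff)
    then have "f i < Suc k" if "i \<in> {1..Suc n}" for i
      using g(1) that by (cases "i = Suc n") (fastforce split: if_splits)+
    moreover have "f i \<le> f (Suc i) \<and> (i \<in> D \<longrightarrow> f i < f (Suc i))" if "i \<in> {1..<Suc n}" for i
    proof (cases "i = n")
      case True
      then show ?thesis using g(1) range[of n] that by (auto split: if_splits)
    next
      case False
      then show ?thesis using g that by (auto simp: labellings_def)
    qed
    ultimately show ?thesis using g by (auto simp: labellings_def PiE_iff extensional_def)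
  qed
qed

text \<open>
  Subtracting the forced increments would turn these sequences into arbitrary weakly increasing ones,
  hence the binomial coefficient. The proof is Pascal's rule applied to the splitting above.
\<close>

lemma card_labellings:
  "card (labellings n k D) = (n + k - 1 - card (D \<inter> {1..<n})) choose n"
proof (induction n arbitrary: k)
  case 0
  have "labellings 0 k D = {\<lambda>_. undefined}" by (auto simp: labellings_def)
  then show ?case by simp
next
  case (Suc n)
  note IH = Suc
  define c where "c = card (D \<inter> {1..<Suc n})"
  have c: "c \<le> n"
    unfolding c_def using card_mono[of "{1..<Suc n}" "D \<inter> {1..<Suc n}"] by auto
  show ?case
  proof (induction k)
    case 0
    have "labellings (Suc n) 0 D = {}" by (auto simp: labellings_def)
    then show ?case by (simp add: binomial_eq_0)
  next
    case (Suc k)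
    \<comment> \<open>The index 0 never is a strict position, so it may be dropped from D.\<close>
    have D0: "labellings m k' (D - {0}) = labellings m k' D" for m k'
      by (auto simp: labellings_def)
    let ?k = "if n \<in> D - {0} then k else Suc k"
    have split: "labellings (Suc n) (Suc k) D = labellings (Suc n) k D \<union>
        (\<lambda>f. f(Suc n := k)) ` labellings n ?k D"
      using labellings_Suc_Suc[of n "D - {0}" k] by (auto simp: D0)
    have disj: "labellings (Suc n) k D \<inter> (\<lambda>f. f(Suc n := k)) ` labellings n ?k D = {}"
    proof -
      have "f (Suc n) < k" if "f \<in> labellings (Suc n) k D" for f
        using that by (auto simp: labellings_def PiE_iff)
      then show ?thesis by fastforce
    qed
    have inj: "inj_on (\<lambda>f. f(Suc n := k)) (labellings n ?k D)"
    proof (rule inj_onI)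
      fix f g assume fg: "f \<in> labellings n ?k D" "g \<in> labellings n ?k D" "f(Suc n := k) = g(Suc n := k)"
      have "f (Suc n) = undefined" "g (Suc n) = undefined"
        using fg by (auto simp: labellings_def PiE_iff extensional_def)
      then show "f = g" using fg(3) by (metis fun_upd_triv fun_upd_upd)
    qed
    have "card (labellings n ?k D) = (n + k - c) choose n"
    proof (cases "n = 0")
      case True
      then show ?thesis using IH[of ?k] by simp
    next
      case False
      then have "D \<inter> {1..<Suc n} = (if n \<in> D - {0} then insert n (D \<inter> {1..<n}) else D \<inter> {1..<n})"
        by (auto simp: less_Suc_eq)
      then have "c = card (D \<inter> {1..<n}) + (if n \<in> D - {0} then 1 else 0)"
        by (simp add: c_def)
      then have "n + ?k - 1 - card (D \<inter> {1..<n}) = n + k - c" using False by auto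
      then show ?thesis using IH[of ?k] by simp
    qed
    then have "card ((\<lambda>f. f(Suc n := k)) ` labellings n ?k D) = (n + k - c) choose n"
      by (simp only: card_image[OF inj])
    then have "card (labellings (Suc n) (Suc k) D) =
        ((n + k - c) choose Suc n) + ((n + k - c) choose n)"
      using Suc unfolding split c_def
      by (subst card_Un_disjoint[OF _ _ disj]) (simp_all add: finite_labellings)
    also have "\<dots> = (Suc n + Suc k - 1 - c) choose Suc n"
      using c by (simp add: Suc_diff_le)
    finally show ?case by (simp add: c_def)
  qed
qed

section \<open>Linear and cyclic descents under rotation\<close>

text \<open>
  The rotation of \<open>{1..n}\<close>, extended by the identity so that it is a permutation in the sense of
  \<open>permutes\<close>.
\<close>

definition cyc_succ :: "nat \<Rightarrow> nat \<Rightarrow> nat" where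
  "cyc_succ n i = (if i \<in> {1..n} then i mod n + 1 else i)"

lemma cyc_succ_eq: "i \<in> {1..n} \<Longrightarrow> cyc_succ n i = (if i = n then 1 else Suc i)"
  by (cases "i = n") (simp_all add: cyc_succ_def)

lemma cyc_succ_permutes: "cyc_succ n permutes {1..n}"
proof (rule bij_imp_permutes)
  have inj: "inj_on (cyc_succ n) {1..n}"
  proof (rule inj_onI)
    fix i j assume "i \<in> {1..n}" "j \<in> {1..n}" "cyc_succ n i = cyc_succ n j"
    then have "(if i = n then 1 else Suc i) = (if j = n then 1 else Suc j)" "i \<noteq> 0" "j \<noteq> 0"
      using cyc_succ_eq[of i n] cyc_succ_eq[of j n] by simp_all
    then show "i = j" by (simp split: if_splits)
  qed
  have "cyc_succ n i \<in> {1..n}" if "i \<in> {1..n}" for i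
    using that unfolding cyc_succ_eq[OF that] by (cases "i = n") simp_all
  then have "cyc_succ n ` {1..n} \<subseteq> {1..n}" by blast
  then have "cyc_succ n ` {1..n} = {1..n}" using inj by (intro endo_inj_surj) simp_all
  then show "bij_betw (cyc_succ n) {1..n} {1..n}" using inj unfolding bij_betw_def by blast
  show "cyc_succ n i = i" if "i \<notin> {1..n}" for i
    using that unfolding cyc_succ_def by (rule if_not_P)
qed

lemma cyc_succ_cong:
  assumes "i \<in> {1..n}"
  shows "int (cyc_succ n i) mod int n = (int i + 1) mod int n"
proof -
  have "int (cyc_succ n i) = int i mod int n + 1"
    using assms by (simp add: cyc_succ_def zmod_int)
  then show ?thesis by (simp add: mod_add_left_eq)
qed

lemma cyc_succ_funpow_last:
  "j \<in> {1..n} \<Longrightarrow> (cyc_succ n ^^ j) n = j"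
proof (induction j)
  case (Suc j)
  then show ?case by (cases "j = 0") (auto simp: cyc_succ_eq)
qed simp

lemma mod_diff_eq_diff_plus_if:
  fixes a b n :: nat
  assumes "a \<in> {1..n}" "b \<in> {1..n}"
  shows "(int b - int a) mod int n = int b - int a + (if a > b then int n else 0)"
proof (cases "a > b")
  case True
  have "(int b - int a) mod int n = (int b - int a + int n) mod int n" by simp
  also have "\<dots> = int b - int a + int n" using True assms by (intro mod_pos_pos_trivial) auto
  finally show ?thesis using True by simp
next
  case False
  have "(int b - int a) mod int n = int b - int a"
    using False assms by (intro mod_pos_pos_trivial) auto
  then show ?thesis using False by simp
qed

text \<open>
  The length of the positively oriented arc from \<open>\<nu> i\<close> to \<open>\<nu> (i + 1)\<close> on the circle of \<open>n\<close> points.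
\<close>

definition gap :: "nat \<Rightarrow> (nat \<Rightarrow> nat) \<Rightarrow> nat \<Rightarrow> int" where
  "gap n \<nu> i = (int (\<nu> (cyc_succ n i)) - int (\<nu> i)) mod int n"

text \<open>
  An arc is longer than the difference of its endpoints by \<open>n\<close> exactly when it is a cyclic descent, and
  the differences telescope. So \<open>\<nu>\<close> winds \<open>perm_deg n \<nu>\<close> times around the circle, which makes the
  degree visibly invariant under rotations of positions and of values.
\<close>

lemma sum_gap_eq_perm_deg:
  assumes "\<nu> permutes {1..n}"
  shows "(\<Sum>i=1..n. gap n \<nu> i) = int n * int (perm_deg n \<nu>)"
proof -
  let ?s = "cyc_succ n"
  have in_range: "\<nu> i \<in> {1..n}" "\<nu> (?s i) \<in> {1..n}" if "i \<in> {1..n}" for i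
    using that assms cyc_succ_permutes by (auto simp del: atLeastAtMost_iff simp: permutes_in_image)
  have "(\<Sum>i=1..n. gap n \<nu> i) =
      (\<Sum>i=1..n. int (\<nu> (?s i)) - int (\<nu> i) + (if \<nu> i > \<nu> (?s i) then int n else 0))"
    unfolding gap_def using in_range by (intro sum.cong refl mod_diff_eq_diff_plus_if) auto
  also have "\<dots> = (\<Sum>i=1..n. int (\<nu> (?s i))) - (\<Sum>i=1..n. int (\<nu> i))
      + (\<Sum>i=1..n. if \<nu> i > \<nu> (?s i) then int n else 0)"
    by (simp add: sum.distrib sum_subtractf)
  also have "(\<Sum>i=1..n. int (\<nu> (?s i))) = (\<Sum>i=1..n. int (\<nu> i))"
    using sum.permute[OF cyc_succ_permutes, of "\<lambda>i. int (\<nu> i)"] by (simp add: o_def)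
  also have "(\<Sum>i=1..n. if \<nu> i > \<nu> (?s i) then int n else 0) =
      int (card {i \<in> {1..n}. \<nu> i > \<nu> (?s i)}) * int n"
    by (simp add: sum.If_cases Int_def)
  also have "{i \<in> {1..n}. \<nu> i > \<nu> (?s i)} = {i \<in> {1..n}. \<nu> i > \<nu> (i mod n + 1)}"
    by (auto simp: cyc_succ_def)
  finally show ?thesis by (simp add: perm_deg_def)
qed

definition rotate_conj :: "nat \<Rightarrow> (nat \<Rightarrow> nat) \<Rightarrow> nat \<Rightarrow> nat" where
  "rotate_conj n \<nu> = inv (cyc_succ n) \<circ> \<nu> \<circ> cyc_succ n"

lemma rotate_conj_in_n_cycles:
  assumes "\<nu> \<in> n_cycles n"
  shows "rotate_conj n \<nu> \<in> n_cycles n"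
proof -
  let ?s = "cyc_succ n"
  have s: "?s permutes {1..n}" "inv ?s permutes {1..n}"
    using cyc_succ_permutes permutes_inv[OF cyc_succ_permutes] .
  have "rotate_conj n \<nu> permutes {1..n}"
    using assms s unfolding rotate_conj_def n_cycles_def
    by (intro permutes_compose) simp_all
  moreover have "cyclic_on (rotate_conj n \<nu>) (inv ?s ` {1..n})"
  proof (rule cyclic_on_image)
    show "cyclic_on \<nu> {1..n}" using assms by (simp add: n_cycles_def)
    show "rotate_conj n \<nu> (inv ?s x) = inv ?s (\<nu> x)" for x
      by (simp add: rotate_conj_def permutes_inverses(1)[OF s(1)])
  qed
  ultimately show ?thesis
    using permutes_image[OF s(2)] by (simp add: n_cycles_def)
qed

lemma finite_n_cycles: "finite (n_cycles n)"
  unfolding n_cycles_def by (rule finite_subset[OF _ finite_permutations[of "{1..n}"]]) auto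

lemma bij_betw_rotate_conj: "bij_betw (rotate_conj n) (n_cycles n) (n_cycles n)"
proof -
  have "inj_on (rotate_conj n) (n_cycles n)"
  proof (rule inj_onI)
    fix \<mu> \<nu> assume eq: "rotate_conj n \<mu> = rotate_conj n \<nu>"
    have "\<mu> = cyc_succ n \<circ> rotate_conj n \<mu> \<circ> inv (cyc_succ n)" for \<mu>
      by (simp add: rotate_conj_def fun_eq_iff permutes_inverses[OF cyc_succ_permutes])
    then show "\<mu> = \<nu>" using eq by metis
  qed
  moreover have "rotate_conj n ` n_cycles n \<subseteq> n_cycles n"
    using rotate_conj_in_n_cycles by blast
  ultimately show ?thesis
    using endo_inj_surj[OF finite_n_cycles] by (simp add: bij_betw_def)
qed

lemma funpow_rotate_conj_in_n_cycles:
  "\<nu> \<in> n_cycles n \<Longrightarrow> (rotate_conj n ^^ j) \<nu> \<in> n_cycles n"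
  by (induction j) (auto intro: rotate_conj_in_n_cycles)

lemma rotate_conj_cong:
  assumes "\<nu> \<in> n_cycles n" "i \<in> {1..n}"
  shows "int (rotate_conj n \<nu> i) mod int n = (int (\<nu> (cyc_succ n i)) - 1) mod int n"
proof -
  let ?s = "cyc_succ n"
  let ?r = "rotate_conj n \<nu>"
  have "?r i \<in> {1..n}"
    using rotate_conj_in_n_cycles[OF assms(1)] assms(2) permutes_in_image[of ?r "{1..n}" i]
    by (simp add: n_cycles_def)
  moreover have "?s (?r i) = \<nu> (?s i)"
    by (simp add: rotate_conj_def permutes_inverses[OF cyc_succ_permutes])
  ultimately have "int (\<nu> (?s i)) mod int n = (int (?r i) + 1) mod int n"
    using cyc_succ_cong by metis
  then have "(int (\<nu> (?s i)) mod int n - 1) mod int n = ((int (?r i) + 1) mod int n - 1) mod int n"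
    by simp
  then show ?thesis by (simp add: mod_simps)
qed

text \<open>
  Modulo \<open>n\<close>, conjugation by the \<open>j\<close>-th power of the rotation shifts the position by \<open>j\<close> and the value
  by \<open>- j\<close>. The congruence avoids the case distinctions at the ends of \<open>{1..n}\<close>.
\<close>

lemma funpow_rotate_conj_cong:
  assumes "\<nu> \<in> n_cycles n" "i \<in> {1..n}"
  shows "int ((rotate_conj n ^^ j) \<nu> i) mod int n =
    (int (\<nu> ((cyc_succ n ^^ j) i)) - int j) mod int n"
  using assms(2)
proof (induction j arbitrary: i)
  case (Suc j)
  let ?\<nu> = "(rotate_conj n ^^ j) \<nu>" and ?s = "cyc_succ n"
  have s: "?s i \<in> {1..n}"
    using Suc.prems permutes_in_image[OF cyc_succ_permutes] by blast
  have "int ((rotate_conj n ^^ Suc j) \<nu> i) mod int n = (int (?\<nu> (?s i)) mod int n - 1) mod int n"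
    using rotate_conj_cong[OF funpow_rotate_conj_in_n_cycles[OF assms(1)] Suc.prems, of j]
    by (simp add: mod_simps)
  also have "\<dots> = (int (\<nu> ((?s ^^ j) (?s i))) - int j - 1) mod int n"
    unfolding Suc.IH[OF s] by (simp add: mod_simps)
  also have "(?s ^^ j) (?s i) = (?s ^^ Suc j) i" by (simp add: funpow_swap1)
  finally show ?case by (simp add: algebra_simps)
qed simp

lemma perm_deg_rotate_conj:
  assumes "\<nu> \<in> n_cycles n" "n > 0"
  shows "perm_deg n (rotate_conj n \<nu>) = perm_deg n \<nu>"
proof -
  let ?s = "cyc_succ n" and ?r = "rotate_conj n \<nu>"
  have s: "?s i \<in> {1..n}" if "i \<in> {1..n}" for i
    using that permutes_in_image[OF cyc_succ_permutes] by blast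
  have "gap n ?r i = gap n \<nu> (?s i)" if i: "i \<in> {1..n}" for i
  proof -
    have "gap n ?r i = (int (?r (?s i)) mod int n - int (?r i) mod int n) mod int n"
      by (simp add: gap_def mod_simps)
    also have "\<dots> = gap n \<nu> (?s i)"
      unfolding rotate_conj_cong[OF assms(1) i] rotate_conj_cong[OF assms(1) s[OF i]]
      by (simp add: gap_def mod_simps)
    finally show ?thesis .
  qed
  then have "(\<Sum>i=1..n. gap n ?r i) = (\<Sum>i=1..n. gap n \<nu> (?s i))" by simp
  also have "\<dots> = (\<Sum>i=1..n. gap n \<nu> i)"
    using sum.permute[OF cyc_succ_permutes, of "gap n \<nu>"] by (simp add: o_def)
  finally have "int n * int (perm_deg n ?r) = int n * int (perm_deg n \<nu>)"
    using assms(1) rotate_conj_in_n_cycles[OF assms(1)] sum_gap_eq_perm_deg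
    unfolding n_cycles_def by (metis (no_types, lifting) mem_Collect_eq)
  then show ?thesis using assms(2) by simp
qed

lemma perm_deg_funpow_rotate_conj:
  assumes "\<nu> \<in> n_cycles n" "n > 0"
  shows "perm_deg n ((rotate_conj n ^^ j) \<nu>) = perm_deg n \<nu>"
  using assms
  by (induction j) (simp_all add: perm_deg_rotate_conj funpow_rotate_conj_in_n_cycles)

lemma n_cycles_no_fixpoint:
  assumes "\<nu> \<in> n_cycles n" "n \<ge> 2" "i \<in> {1..n}"
  shows "\<nu> i \<noteq> i"
proof -
  have "cyclic_on \<nu> {1..n}" using assms by (simp add: n_cycles_def)
  then show ?thesis
    using eq_on_cyclic_on_iff1[of \<nu> "{1..n}" i] assms by auto
qed

text \<open>
  Among the \<open>n\<close> rotated copies of \<open>\<nu>\<close>, precisely \<open>d - 1\<close> have a descent from the last position back to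
  the first, where \<open>d\<close> is the degree. Geometrically, such a descent in the \<open>j\<close>-th copy says that the arc
  from \<open>\<nu> j\<close> to \<open>\<nu> (j + 1)\<close> covers the arc from \<open>j\<close> to \<open>j + 1\<close>, and so marks a fixed point of the circle
  map of degree \<open>d\<close> that interpolates \<open>\<nu>\<close>; such a map has \<open>d - 1\<close> fixed points. The proof sums
  residues instead: with \<open>h i\<close> the residue of \<open>\<nu> i - i\<close>, which is nonzero since \<open>\<nu>\<close> has no fixed point, the
  \<open>j\<close>-th copy has last value \<open>h j\<close> and first value \<open>h (j + 1) + 1\<close>, and the sums of \<open>h\<close> cancel.
\<close>

lemma card_rotations_with_wrap_descent:
  assumes \<nu>: "\<nu> \<in> n_cycles n" and n: "n \<ge> 2"
  shows "int (card {j \<in> {1..n}. (rotate_conj n ^^ j) \<nu> n > (rotate_conj n ^^ j) \<nu> 1}) =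
    int (perm_deg n \<nu>) - 1"
proof -
  let ?s = "cyc_succ n"
  let ?r = "\<lambda>j. (rotate_conj n ^^ j) \<nu>"
  define h where "h i = (int (\<nu> i) - int i) mod int n" for i
  have perm: "\<nu> permutes {1..n}" using \<nu> by (simp add: n_cycles_def)
  have \<nu>_in: "\<nu> i \<in> {1..n}" if "i \<in> {1..n}" for i 
    using that permutes_in_image[OF perm] by blast
  have s_in: "?s i \<in> {1..n}" if "i \<in> {1..n}" for i
    using that permutes_in_image[OF cyc_succ_permutes] by blast
  have r_in: "?r j i \<in> {1..n}" if "i \<in> {1..n}" for i j
    using that funpow_rotate_conj_in_n_cycles[OF \<nu>, of j] permutes_in_image[of "?r j" "{1..n}"]
    by (simp add: n_cycles_def)
  have ends: "1 \<in> {1..n}" "n \<in> {1..n}" using n by auto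
  have h_pos: "0 < h i" if "i \<in> {1..n}" for i
  proof -
    have "h i = int (\<nu> i) - int i + (if i > \<nu> i then int n else 0)"
      unfolding h_def using mod_diff_eq_diff_plus_if[OF that \<nu>_in[OF that]] .
    then show ?thesis using that \<nu>_in[OF that] n_cycles_no_fixpoint[OF \<nu> n that] by auto
  qed
  have last: "int (?r j n) = h j" if j: "j \<in> {1..n}" for j
  proof -
    have "int (?r j n) mod int n = h j"
      using funpow_rotate_conj_cong[OF \<nu> ends(2), of j] cyc_succ_funpow_last[OF j]
      by (simp add: h_def)
    moreover from this have "?r j n \<noteq> n" using h_pos[OF j] by auto
    ultimately show ?thesis using r_in[OF ends(2), of j] by simp
  qed
  have s_pow: "(?s ^^ j) 1 = ?s j" if j: "j \<in> {1..n}" for j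
  proof -
    have "(?s ^^ j) (?s n) = ?s ((?s ^^ j) n)" by (rule funpow_swap1[symmetric])
    then show ?thesis using cyc_succ_funpow_last[OF j] ends by (simp add: cyc_succ_eq)
  qed
  have first: "int (?r j 1) = h (?s j) + 1" if j: "j \<in> {1..n}" for j
  proof -
    have "(int (?r j 1) - 1) mod int n = (int (?r j 1) mod int n - 1) mod int n"
      by (simp add: mod_simps)
    also have "\<dots> = (int (\<nu> (?s j)) - (int j + 1) mod int n) mod int n"
      unfolding funpow_rotate_conj_cong[OF \<nu> ends(1)] s_pow[OF j]
      by (simp add: mod_simps algebra_simps)
    also have "\<dots> = h (?s j)"
      unfolding cyc_succ_cong[OF j, symmetric] by (simp add: h_def mod_simps)
    finally show ?thesis using r_in[OF ends(1), of j] by simp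
  qed
  have gap: "(int (?r j 1) - int (?r j n)) mod int n = gap n \<nu> j" if j: "j \<in> {1..n}" for j
  proof -
    have "(int (?r j 1) - int (?r j n)) mod int n =
        (int (?r j 1) mod int n - int (?r j n) mod int n) mod int n" by (simp add: mod_simps)
    also have "\<dots> = gap n \<nu> j"
      unfolding funpow_rotate_conj_cong[OF \<nu> ends(1)] s_pow[OF j]
        funpow_rotate_conj_cong[OF \<nu> ends(2)] cyc_succ_funpow_last[OF j]
      by (simp add: gap_def mod_simps)
    finally show ?thesis .
  qed
  have "int n * int (perm_deg n \<nu>) = (\<Sum>j=1..n. gap n \<nu> j)"
    using sum_gap_eq_perm_deg[OF perm] by simp
  also have "\<dots> = (\<Sum>j=1..n. h (?s j) + 1 - h j + (if ?r j n > ?r j 1 then int n else 0))"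
  proof (rule sum.cong[OF refl])
    fix j assume j: "j \<in> {1..n}"
    show "gap n \<nu> j = h (?s j) + 1 - h j + (if ?r j n > ?r j 1 then int n else 0)"
      unfolding gap[OF j, symmetric] last[OF j, symmetric] first[OF j, symmetric]
      by (rule mod_diff_eq_diff_plus_if) (use r_in ends in auto)
  qed
  also have "\<dots> = (\<Sum>j=1..n. h (?s j)) - (\<Sum>j=1..n. h j) + int n +
      (\<Sum>j=1..n. if ?r j n > ?r j 1 then int n else 0)"
    by (simp add: sum.distrib sum_subtractf)
  also have "(\<Sum>j=1..n. h (?s j)) = (\<Sum>j=1..n. h j)"
    using sum.permute[OF cyc_succ_permutes, of h] by (simp add: o_def)
  also have "(\<Sum>j=1..n. if ?r j n > ?r j 1 then int n else 0) =
      int (card {j \<in> {1..n}. ?r j n > ?r j 1}) * int n"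
    by (simp add: sum.If_cases Int_def)
  finally have "int n * (int (perm_deg n \<nu>) - 1) = int n * int (card {j \<in> {1..n}. ?r j n > ?r j 1})"
    by (simp add: algebra_simps)
  then show ?thesis using n by simp
qed

definition descents :: "nat \<Rightarrow> (nat \<Rightarrow> nat) \<Rightarrow> nat set" where
  "descents n \<nu> = {i \<in> {1..<n}. \<nu> i > \<nu> (Suc i)}"

lemma perm_deg_eq_card_descents:
  assumes "n > 0"
  shows "perm_deg n \<nu> = card (descents n \<nu>) + (if \<nu> n > \<nu> 1 then 1 else 0)"
proof -
  have "{i \<in> {1..n}. \<nu> i > \<nu> (i mod n + 1)} = descents n \<nu> \<union> (if \<nu> n > \<nu> 1 then {n} else {})"
  proof (rule set_eqI)
    fix i
    show "i \<in> {i \<in> {1..n}. \<nu> i > \<nu> (i mod n + 1)} \<longleftrightarrow>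
        i \<in> descents n \<nu> \<union> (if \<nu> n > \<nu> 1 then {n} else {})"
      using assms by (cases "i = n"; cases "i < n") (simp_all add: descents_def)
  qed
  moreover have "finite (descents n \<nu>)" "n \<notin> descents n \<nu>" by (auto simp: descents_def)
  ultimately show ?thesis by (simp add: perm_deg_def)
qed

lemma perm_deg_le: "perm_deg n \<nu> \<le> n"
proof -
  have "perm_deg n \<nu> \<le> card {1..n}" unfolding perm_deg_def by (rule card_mono) auto
  then show ?thesis by simp
qed

lemma times_binomial_minus1_int:
  "int (Suc n) * int (m choose Suc n) = (int m - int n) * int (m choose n)"
proof (cases "n \<le> m")
  case True
  have "Suc n * (m choose Suc n) = (m - n) * (m choose n)"
    by (metis binomial_absorb_comp binomial_absorption)
  then show ?thesis using True by (metis of_nat_diff of_nat_mult)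
qed (simp add: binomial_eq_0)

text \<open>
  Replacing \<open>\<nu>\<close> by its rotated copies permutes the \<open>n\<close>-cycles, so the left-hand side may be averaged
  over the copies. Of these, \<open>d - 1\<close> have \<open>d - 1\<close> linear descents and the others have \<open>d\<close>. With
  \<open>m = n - 1 + k - d\<close> this gives \<open>n * (m choose n) + (d - 1) * (m choose (n - 1))\<close>, and
  \<open>n * (m choose n) = (k - d) * (m choose (n - 1))\<close>, so that the dependence of the factor on \<open>d\<close>
  disappears.
\<close>

lemma sum_binomial_descents_eq_sum_binomial_perm_deg:
  assumes n: "n \<ge> 2" and k: "k \<ge> 1"
  shows "int n * (\<Sum>\<nu>\<in>n_cycles n. int ((n + k - 1 - card (descents n \<nu>)) choose n)) =
    (int k - 1) * (\<Sum>\<nu>\<in>n_cycles n. int ((n - 1 + k - perm_deg n \<nu>) choose (n - 1)))"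
proof -
  let ?r = "\<lambda>j. rotate_conj n ^^ j"
  let ?b = "\<lambda>\<nu>. int ((n + k - 1 - card (descents n \<nu>)) choose n)"
  have inner: "(\<Sum>j=1..n. ?b (?r j \<nu>)) =
      (int k - 1) * int ((n - 1 + k - perm_deg n \<nu>) choose (n - 1))"
    if \<nu>: "\<nu> \<in> n_cycles n" for \<nu>
  proof -
    define d where "d = perm_deg n \<nu>"
    define m where "m = n - 1 + k - d"
    let ?W = "{j \<in> {1..n}. ?r j \<nu> n > ?r j \<nu> 1}"
    have W: "int (card ?W) = int d - 1"
      using card_rotations_with_wrap_descent[OF \<nu> n] by (simp add: d_def)
    have "d \<le> n" unfolding d_def by (rule perm_deg_le)
    then have m: "int m = int n - 1 + int k - int d" using k n by (auto simp: m_def)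
    have des: "card (descents n (?r j \<nu>)) = (if j \<in> ?W then d - 1 else d)"
      if "j \<in> {1..n}" for j
      using perm_deg_eq_card_descents[of n "?r j \<nu>"] perm_deg_funpow_rotate_conj[OF \<nu>, of j] n that
      by (auto simp: d_def)
    have d1: "d \<ge> 1" using W by auto
    have "(\<Sum>j=1..n. ?b (?r j \<nu>)) =
        (\<Sum>j=1..n. int (m choose n) + (if j \<in> ?W then int (m choose (n - 1)) else 0))"
    proof (rule sum.cong[OF refl])
      fix j assume j: "j \<in> {1..n}"
      have "n + k - 1 - card (descents n (?r j \<nu>)) = (if j \<in> ?W then Suc m else m)"
        unfolding des[OF j] m_def using d1 \<open>d \<le> n\<close> n k by auto
      moreover have "Suc m choose n = (m choose n) + (m choose (n - 1))"
        using n by (cases n) simp_all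
      ultimately show "?b (?r j \<nu>) =
          int (m choose n) + (if j \<in> ?W then int (m choose (n - 1)) else 0)" by auto
    qed
    also have "\<dots> = int n * int (m choose n) + int (card ?W) * int (m choose (n - 1))"
    proof -
      have "(\<Sum>j=1..n. if j \<in> ?W then int (m choose (n - 1)) else 0) =
          (\<Sum>j\<in>?W. int (m choose (n - 1)))"
        by (rule sum.mono_neutral_cong_right) auto
      then show ?thesis by (simp only: sum.distrib) simp
    qed
    also have "int n * int (m choose n) = (int m - int (n - 1)) * int (m choose (n - 1))"
      using times_binomial_minus1_int[of "n - 1" m] n by simp
    finally have "(\<Sum>j=1..n. ?b (?r j \<nu>)) =
        (int m - int (n - 1) + int (card ?W)) * int (m choose (n - 1))"
      by (simp only: distrib_right)
    also have "int m - int (n - 1) + int (card ?W) = int k - 1"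
      unfolding W m using n by simp
    finally show ?thesis by (simp only: m_def d_def)
  qed
  have "int n * sum ?b (n_cycles n) = (\<Sum>j=1..n. sum ?b (n_cycles n))" by simp
  also have "\<dots> = (\<Sum>j=1..n. \<Sum>\<nu>\<in>n_cycles n. ?b (?r j \<nu>))"
    by (intro sum.cong refl sum.reindex_bij_betw[symmetric] bij_betw_funpow bij_betw_rotate_conj)
  also have "\<dots> = (\<Sum>\<nu>\<in>n_cycles n. \<Sum>j=1..n. ?b (?r j \<nu>))" by (rule sum.swap)
  also have "\<dots> = (\<Sum>\<nu>\<in>n_cycles n. (int k - 1) * int ((n - 1 + k - perm_deg n \<nu>) choose (n - 1)))"
    by (intro sum.cong refl inner)
  finally show ?thesis by (simp add: sum_distrib_left)
qed

section \<open>Periodic points of multiplication by \<open>k\<close>\<close>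

text \<open>
  A discrete form of the circle map \<open>t \<mapsto> k t\<close>: the points of \<open>\<real>/\<int>\<close> whose period under it
  divides \<open>n\<close> are the multiples of \<open>1 / (k ^ n - 1)\<close>, and \<open>times_mod\<close> acts on their numerators.
\<close>

definition times_mod :: "nat \<Rightarrow> nat \<Rightarrow> nat \<Rightarrow> nat" where
  "times_mod n k x = k * x mod (k ^ n - 1)"

definition exact_period_points :: "nat \<Rightarrow> nat \<Rightarrow> nat set" where
  "exact_period_points n k =
    {x \<in> {..<k ^ n - 1}. \<forall>r. 0 < r \<and> r < n \<longrightarrow> (times_mod n k ^^ r) x \<noteq> x}"

lemma funpow_times_mod:
  "x < k ^ n - 1 \<Longrightarrow> (times_mod n k ^^ r) x = k ^ r * x mod (k ^ n - 1)"
proof (induction r)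
  case (Suc r)
  then show ?case by (simp add: times_mod_def mod_mult_right_eq mult.assoc)
qed simp

lemma funpow_times_mod_period:
  assumes "x < k ^ n - 1"
  shows "(times_mod n k ^^ n) x = x"
proof -
  have "k ^ n = Suc (k ^ n - 1)" using assms by simp
  then have "k ^ n * x = x + x * (k ^ n - 1)" by (metis mult.commute mult_Suc)
  then have "k ^ n * x mod (k ^ n - 1) = x mod (k ^ n - 1)"
    by (metis mod_mult_self1)
  then show ?thesis using assms by (simp add: funpow_times_mod)
qed

text \<open>
  Since \<open>r\<close> divides \<open>n\<close>, the modulus factors as \<open>(k ^ r - 1) * q\<close>, and the fixed points of the \<open>r\<close>-th
  iterate are the multiples of \<open>q\<close>.
\<close>

lemma card_times_mod_fixed_points:
  assumes n: "n > 0" and k: "k \<ge> 2" and r: "r dvd n"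
  shows "int (card {x \<in> {..<k ^ n - 1}. (times_mod n k ^^ r) x = x}) = int k ^ r - 1"
proof -
  obtain c where c: "n = r * c" using r by auto
  have r0: "r > 0" and c0: "c > 0" using c n by auto
  define K where "K = k ^ r - 1"
  have kr: "k ^ r > 1" using k r0 by (intro one_less_power) auto
  then have K0: "K > 0" by (simp add: K_def)
  define q where "q = (\<Sum>i<c. (k ^ r) ^ i)"
  have M: "k ^ n - 1 = K * q"
  proof -
    have "int (k ^ n - 1) = (int k ^ r) ^ c - 1"
      using k by (simp add: c power_mult of_nat_diff)
    also have "\<dots> = (int k ^ r - 1) * (\<Sum>i<c. (int k ^ r) ^ i)" by (rule power_diff_1_eq)
    also have "\<dots> = int (K * q)" using kr by (simp add: K_def q_def of_nat_diff)
    finally show ?thesis by linarith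
  qed
  have fixed: "(times_mod n k ^^ r) x = x \<longleftrightarrow> q dvd x" if x: "x < k ^ n - 1" for x
  proof -
    have "(times_mod n k ^^ r) x = x \<longleftrightarrow> k ^ r * x mod (K * q) = x mod (K * q)"
      unfolding funpow_times_mod[OF x] using x by (simp only: M mod_less)
    also have "\<dots> \<longleftrightarrow> K * q dvd k ^ r * x - x"
      using kr by (intro mod_eq_dvd_iff_nat) simp
    also have "k ^ r * x - x = K * x" by (simp add: K_def diff_mult_distrib)
    also have "K * q dvd K * x \<longleftrightarrow> q dvd x" using K0 by simp
    finally show ?thesis .
  qed
  have q0: "q > 0"
  proof -
    have "k ^ n > 1" using k n by (intro one_less_power) auto
    then show ?thesis using M by (cases "q = 0") auto
  qed
  have "{x \<in> {..<k ^ n - 1}. (times_mod n k ^^ r) x = x} = (*) q ` {..<K}"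
  proof (rule set_eqI)
    fix x
    have "x \<in> {x \<in> {..<k ^ n - 1}. (times_mod n k ^^ r) x = x} \<longleftrightarrow> x < K * q \<and> q dvd x"
      using fixed[of x] M by auto
    also have "\<dots> \<longleftrightarrow> x \<in> (*) q ` {..<K}"
      using q0 by (auto simp: mult.commute)
    finally show "x \<in> {x \<in> {..<k ^ n - 1}. (times_mod n k ^^ r) x = x} \<longleftrightarrow> x \<in> (*) q ` {..<K}" .
  qed
  moreover have "inj_on ((*) q) {..<K}" using q0 by (intro inj_onI) simp
  ultimately have "card {x \<in> {..<k ^ n - 1}. (times_mod n k ^^ r) x = x} = K"
    by (simp add: card_image)
  then show ?thesis using kr by (simp add: K_def of_nat_diff)
qed

lemma card_exact_period_points_eq_Delta:
  assumes n: "n > 0" and k: "k \<ge> 2"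
  shows "int (card (exact_period_points n k)) = (int k - 1) * Delta n k"
proof -
  have "int (card (exact_period_points n k)) =
      (\<Sum>r | r dvd n. moebius_mu (n div r) *
        int (card {x \<in> {..<k ^ n - 1}. (times_mod n k ^^ r) x = x}))"
    unfolding exact_period_points_def
    by (rule card_exact_period_eq_moebius_sum) (simp_all add: n funpow_times_mod_period)
  also have "\<dots> = (\<Sum>r | r dvd n. moebius_mu (n div r) * (int k ^ r - 1))"
    using card_times_mod_fixed_points[OF n k] by (intro sum.cong refl) (simp only: mem_Collect_eq)
  also have "\<dots> = (\<Sum>r | r dvd n. (int k - 1) * (moebius_mu (n div r) * (\<Sum>j<r. int k ^ j)))"
    by (simp add: power_diff_1_eq mult.left_commute)
  finally show ?thesis by (simp add: Delta_def sum_distrib_left)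
qed

section \<open>Base \<open>k\<close> expansions read off along a cycle\<close>

lemma n_cycles_funpow:
  assumes "\<nu> \<in> n_cycles n" and "i \<in> {1..n}"
  shows "(\<nu> ^^ n) i = i" and "inj_on (\<lambda>t. (\<nu> ^^ t) i) {0..<n}"
    and "(\<lambda>t. (\<nu> ^^ t) i) ` {0..<n} = {1..n}"
proof -
  have "cyclic_on \<nu> {1..n}" using assms by (simp add: n_cycles_def)
  then have orb: "orbit \<nu> i = {1..n}" using assms(2) by (rule orbit_cyclic_eq3)
  then have self: "i \<in> orbit \<nu> i" using assms(2) by simp
  have "card (orbit \<nu> i) = funpow_dist1 \<nu> i i"
    unfolding orbit_conv_funpow_dist1[OF self]
    using card_image[OF inj_on_funpow_dist1[OF self]] by simp
  then have D: "funpow_dist1 \<nu> i i = n" unfolding orb by simp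
  show "(\<nu> ^^ n) i = i" using funpow_dist1_prop[OF self] unfolding D .
  show "inj_on (\<lambda>t. (\<nu> ^^ t) i) {0..<n}" using inj_on_funpow_dist1[OF self] unfolding D .
  show "(\<lambda>t. (\<nu> ^^ t) i) ` {0..<n} = {1..n}"
    using orbit_conv_funpow_dist1[OF self] unfolding D orb by simp
qed

lemma funpow_n_cycles_in:
  assumes "\<nu> \<in> n_cycles n" and "i \<in> {1..n}"
  shows "(\<nu> ^^ t) i \<in> {1..n}"
  using cyclic_on_funpow_in[of \<nu> "{1..n}" i t] assms by (simp add: n_cycles_def)

text \<open>
  The map \<open>\<nu>\<close> can reverse the order of two positions only if their labels differ. This is why the label
  sequences along orbits compare like digit expansions: the first difference decides.
\<close>

lemma labellings_order:
  assumes \<nu>: "\<nu> \<in> n_cycles n" and f: "f \<in> labellings n k (descents n \<nu>)"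
    and ij: "1 \<le> i" "i < j" "j \<le> n"
  shows "f i \<le> f j" and "f i = f j \<Longrightarrow> \<nu> i < \<nu> j"
proof -
  have "inj \<nu>" using \<nu> permutes_inj by (auto simp: n_cycles_def)
  then have ne: "\<nu> i \<noteq> \<nu> j" using ij by (auto dest: injD)
  have "i \<le> j" using ij by simp
  then have "f i \<le> f j \<and> (f i = f j \<longrightarrow> \<nu> i \<le> \<nu> j)" using ij(3)
  proof (induction j rule: dec_induct)
    case (step m)
    then have m: "m \<in> {1..<n}" using ij(1) by auto
    have "f m \<le> f (Suc m)" "m \<in> descents n \<nu> \<longrightarrow> f m < f (Suc m)"
      using f m by (auto simp: labellings_def)
    then have "f m \<le> f (Suc m)" "f m = f (Suc m) \<longrightarrow> \<nu> m \<le> \<nu> (Suc m)"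
      using m by (auto simp: descents_def)
    then show ?case using step by (auto intro: order.trans)
  qed simp
  then show "f i \<le> f j" and "f i = f j \<Longrightarrow> \<nu> i < \<nu> j"
    using ne by auto
qed

text \<open>
  If two points \<open>i < j\<close> had the same label sequence, then all iterates would preserve their order. As
  \<open>j\<close> is the \<open>r\<close>-th iterate of \<open>i\<close> for some \<open>r\<close>, the iterates of \<open>i\<close> at multiples of \<open>r\<close> would increase
  forever inside \<open>{1..n}\<close>.
\<close>

lemma labellings_separate:
  assumes \<nu>: "\<nu> \<in> n_cycles n" and f: "f \<in> labellings n k (descents n \<nu>)"
    and ij: "i \<in> {1..n}" "j \<in> {1..n}" "i < j"
  shows "\<exists>t. f ((\<nu> ^^ t) i) \<noteq> f ((\<nu> ^^ t) j)"
proof (rule ccontr)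
  assume "\<not> ?thesis"
  then have eq: "f ((\<nu> ^^ t) i) = f ((\<nu> ^^ t) j)" for t by blast
  have in_range: "(\<nu> ^^ t) i \<in> {1..n}" "(\<nu> ^^ t) j \<in> {1..n}" for t
    using funpow_n_cycles_in[OF \<nu>] ij by blast+
  have less: "(\<nu> ^^ t) i < (\<nu> ^^ t) j" for t
  proof (induction t)
    case (Suc t)
    then show ?case
      using labellings_order(2)[OF \<nu> f _ Suc _ eq] in_range[of t] by simp
  qed (use ij in simp)
  obtain r where r: "j = (\<nu> ^^ r) i"
    using n_cycles_funpow(3)[OF \<nu> ij(1)] ij(2) by (metis imageE)
  have "strict_mono (\<lambda>m. (\<nu> ^^ (m * r)) i)"
  proof (rule strict_mono_Suc_iff[THEN iffD2, rule_format])
    fix m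
    have "(\<nu> ^^ (Suc m * r)) i = (\<nu> ^^ (m * r)) j"
      unfolding r by (simp add: add.commute[of r] funpow_add)
    then show "(\<nu> ^^ (m * r)) i < (\<nu> ^^ (Suc m * r)) i" using less[of "m * r"] by simp
  qed
  then have "Suc n \<le> (\<nu> ^^ (Suc n * r)) i" by (rule strict_mono_imp_increasing)
  then show False using in_range(1)[of "Suc n * r"] by simp
qed

text \<open>
  The number whose \<open>n\<close> digits in base \<open>k\<close> are the labels met along the orbit of \<open>i\<close>. Divided by
  \<open>k ^ n - 1\<close>, it is the point of the circle with the corresponding periodic expansion.
\<close>

definition expansion :: "nat \<Rightarrow> nat \<Rightarrow> (nat \<Rightarrow> nat) \<Rightarrow> (nat \<Rightarrow> nat) \<Rightarrow> nat \<Rightarrow> nat" where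
  "expansion n k \<nu> f i = (\<Sum>t<n. f ((\<nu> ^^ t) i) * k ^ (n - 1 - t))"

lemma digit_sum_less:
  fixes g :: "nat \<Rightarrow> nat"
  assumes "\<And>t. t < n \<Longrightarrow> g t < k"
  shows "(\<Sum>t<n. g t * k ^ (n - 1 - t)) < k ^ n"
  using assms
proof (induction n)
  case (Suc n)
  let ?s = "\<Sum>t<n. g t * k ^ (n - 1 - t)"
  have shift: "g t * k ^ (n - t) = k * (g t * k ^ (n - 1 - t))" if "t < n" for t
  proof -
    have "k ^ (n - t) = k * k ^ (n - 1 - t)"
      using power_minus_mult[of "n - t" k] that by (simp add: mult.commute)
    then show ?thesis by (simp only: mult.left_commute)
  qed
  have "(\<Sum>t<n. g t * k ^ (n - t)) = k * ?s"
    unfolding sum_distrib_left by (intro sum.cong refl shift) simp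
  then have "(\<Sum>t<Suc n. g t * k ^ (Suc n - 1 - t)) = k * ?s + g n"
    by simp
  also have "\<dots> < k * ?s + k" using Suc.prems[of n] by simp
  also have "\<dots> = k * Suc ?s" by simp
  also have "\<dots> \<le> k * k ^ n" using Suc.IH Suc.prems by (intro mult_le_mono2 Suc_leI) simp
  finally show ?case by simp
qed simp

text \<open>
  Multiplication by \<open>k\<close> shifts the digits; the leading digit \<open>f i\<close> reappears as the last digit because
  \<open>\<nu>\<close> returns to \<open>i\<close> after \<open>n\<close> steps. The equation is written additively to avoid the truncated
  difference \<open>k ^ n - 1\<close>.
\<close>

lemma expansion_step:
  assumes "(\<nu> ^^ n) i = i" "n > 0"
  shows "k * expansion n k \<nu> f i + f i = k ^ n * f i + expansion n k \<nu> f (\<nu> i)"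
proof -
  obtain m where n: "n = Suc m" using assms(2) by (cases n) auto
  let ?g = "\<lambda>t. f ((\<nu> ^^ t) i)"
  have "k * expansion n k \<nu> f i = (\<Sum>t<n. ?g t * k ^ (n - t))"
    unfolding expansion_def sum_distrib_left
  proof (intro sum.cong refl)
    fix t assume "t \<in> {..<n}"
    then have "k ^ (n - t) = k * k ^ (n - 1 - t)"
      using power_minus_mult[of "n - t" k] by (simp add: mult.commute)
    then show "k * (?g t * k ^ (n - 1 - t)) = ?g t * k ^ (n - t)"
      by (simp only: mult.left_commute)
  qed
  also have "\<dots> = f i * k ^ n + (\<Sum>t<m. ?g (Suc t) * k ^ (m - t))"
    unfolding n sum.lessThan_Suc_shift by simp
  finally have 1: "k * expansion n k \<nu> f i = f i * k ^ n + (\<Sum>t<m. ?g (Suc t) * k ^ (m - t))" .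
  have "expansion n k \<nu> f (\<nu> i) = (\<Sum>t<n. ?g (Suc t) * k ^ (m - t))"
    by (simp add: expansion_def n funpow_swap1)
  also have "\<dots> = (\<Sum>t<m. ?g (Suc t) * k ^ (m - t)) + f i"
    unfolding n using assms(1) by (simp add: n)
  finally show ?thesis using 1 by simp
qed

lemma expansion_step_minus1:
  assumes "\<nu> \<in> n_cycles n" "i \<in> {1..n}" "k \<ge> 2"
  shows "k * expansion n k \<nu> f i = (k ^ n - 1) * f i + expansion n k \<nu> f (\<nu> i)"
proof -
  have n: "n > 0" using assms by auto
  have "k ^ n * f i = (k ^ n - 1) * f i + f i"
  proof -
    have "k ^ n = Suc (k ^ n - 1)" using assms(3) by simp
    then show ?thesis by (metis add.commute mult_Suc)
  qed
  then show ?thesis using expansion_step[OF n_cycles_funpow(1)[OF assms(1,2)] n, of k f] by simp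
qed

text \<open>
  The value \<open>k ^ n - 1\<close> would force every digit to be \<open>k - 1\<close>, hence a constant labelling, but labels
  separate points.
\<close>

lemma expansion_less:
  assumes \<nu>: "\<nu> \<in> n_cycles n" and f: "f \<in> labellings n k (descents n \<nu>)"
    and n: "n \<ge> 2" and k: "k \<ge> 2" and i: "i \<in> {1..n}"
  shows "expansion n k \<nu> f i < k ^ n - 1"
proof (rule ccontr)
  let ?X = "expansion n k \<nu> f"
  let ?M = "k ^ n - 1"
  assume *: "\<not> ?X i < ?M"
  have f_less: "f j < k" if "j \<in> {1..n}" for j
    using f that by (auto simp: labellings_def PiE_iff)
  have le: "?X j \<le> ?M" if "j \<in> {1..n}" for j
  proof -
    have "?X j < k ^ n" unfolding expansion_def
      by (rule digit_sum_less) (use f_less funpow_n_cycles_in[OF \<nu> that] in blast)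
    then show ?thesis by simp
  qed
  have in_range: "(\<nu> ^^ t) j \<in> {1..n}" if "j \<in> {1..n}" for j t
    using funpow_n_cycles_in[OF \<nu> that] .
  have M0: "?M > 0" using one_less_power[of k n] k n by simp
  have top: "f j = k - 1 \<and> ?X (\<nu> j) = ?M" if j: "j \<in> {1..n}" "?X j = ?M" for j
  proof -
    have eq: "k * ?M = ?M * f j + ?X (\<nu> j)"
      using expansion_step_minus1[OF \<nu> j(1) k, of f] j(2) by simp
    have \<nu>j: "?X (\<nu> j) \<le> ?M" using le[OF in_range[OF j(1), of 1]] by simp
    have "f j = k - 1"
    proof (rule ccontr)
      assume "f j \<noteq> k - 1"
      then have "f j + 2 \<le> k" using f_less[OF j(1)] by simp
      then have "?M * (f j + 2) \<le> ?M * k" by (rule mult_le_mono2)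
      then have "?M * f j + ?M * 2 \<le> k * ?M"
        unfolding add_mult_distrib2 by (simp only: mult.commute)
      then show False using eq \<nu>j M0 by linarith
    qed
    moreover have "?M * (k - 1) + ?M = k * ?M"
    proof -
      have "?M * (k - 1) + ?M = ?M * (k - 1 + 1)" by (simp only: add_mult_distrib2 mult_1_right)
      also have "k - 1 + 1 = k" using k by simp
      finally show ?thesis by (simp only: mult.commute)
    qed
    ultimately show ?thesis using eq by simp
  qed
  have "?X i = ?M" using * le[OF i] by simp
  then have "?X ((\<nu> ^^ t) i) = ?M" for t
    by (induction t) (use top in_range[OF i] in auto)
  then have const: "f ((\<nu> ^^ t) i) = k - 1" for t using top in_range[OF i] by blast
  have all: "f j = k - 1" if "j \<in> {1..n}" for j
    using const n_cycles_funpow(3)[OF \<nu> i] that by (metis imageE)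
  have ends: "1 \<in> {1..n}" "n \<in> {1..n}" "1 < n" using n by auto
  show False
    using labellings_separate[OF \<nu> f ends] all in_range[OF ends(1)] in_range[OF ends(2)] by metis
qed

text \<open>
  Suppose that \<open>i < j\<close> but the expansions are not in this order. By the recursion for expansions a smaller
  leading digit cannot be compensated by the rest, so the digits agree and the situation
  passes on to the images. Thus \<open>i\<close> and \<open>j\<close> have equal label sequences, which is impossible.
\<close>

lemma expansion_strict_mono:
  assumes \<nu>: "\<nu> \<in> n_cycles n" and f: "f \<in> labellings n k (descents n \<nu>)"
    and n: "n \<ge> 2" and k: "k \<ge> 2"
  shows "strict_mono_on {1..n} (expansion n k \<nu> f)"
proof (rule strict_mono_onI, rule ccontr)
  let ?X = "expansion n k \<nu> f"
  let ?M = "k ^ n - 1"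
  fix i j assume i: "i \<in> {1..n}" and j: "j \<in> {1..n}" and ij: "i < j" "\<not> ?X i < ?X j"
  have step: "f a = f b \<and> \<nu> a < \<nu> b \<and> ?X (\<nu> b) \<le> ?X (\<nu> a)"
    if ab: "a \<in> {1..n}" "b \<in> {1..n}" "a < b" "?X b \<le> ?X a" for a b
  proof -
    have a: "k * ?X a = ?M * f a + ?X (\<nu> a)" and b: "k * ?X b = ?M * f b + ?X (\<nu> b)"
      using expansion_step_minus1[OF \<nu> _ k, of _ f] ab by blast+
    have le: "k * ?X b \<le> k * ?X a" using ab(4) by simp
    have "f a \<le> f b" using labellings_order(1)[OF \<nu> f, of a b] ab by simp
    moreover have "\<not> f a < f b"
    proof
      assume "f a < f b"
      then have "?M * Suc (f a) \<le> ?M * f b" by (intro mult_le_mono2) simp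
      moreover have "?X (\<nu> a) < ?M"
        using expansion_less[OF \<nu> f n k funpow_n_cycles_in[OF \<nu> ab(1), of 1]] by simp
      ultimately show False using a b le by simp
    qed
    ultimately have "f a = f b" by simp
    moreover from this have "\<nu> a < \<nu> b" using labellings_order(2)[OF \<nu> f, of a b] ab by simp
    ultimately show ?thesis using a b le by simp
  qed
  have in_range: "(\<nu> ^^ t) i \<in> {1..n}" "(\<nu> ^^ t) j \<in> {1..n}" for t
    using funpow_n_cycles_in[OF \<nu>] i j by blast+
  have ord: "(\<nu> ^^ t) i < (\<nu> ^^ t) j \<and> ?X ((\<nu> ^^ t) j) \<le> ?X ((\<nu> ^^ t) i)" for t
    by (induction t) (use ij step in_range in auto)
  then have "f ((\<nu> ^^ t) i) = f ((\<nu> ^^ t) j)" for t using step in_range by blast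
  then show False using labellings_separate[OF \<nu> f i j ij(1)] by blast
qed

lemma times_mod_expansion:
  assumes \<nu>: "\<nu> \<in> n_cycles n" and f: "f \<in> labellings n k (descents n \<nu>)"
    and n: "n \<ge> 2" and k: "k \<ge> 2" and i: "i \<in> {1..n}"
  shows "times_mod n k (expansion n k \<nu> f i) = expansion n k \<nu> f (\<nu> i)"
    and "k * expansion n k \<nu> f i div (k ^ n - 1) = f i"
proof -
  have less: "expansion n k \<nu> f (\<nu> i) < k ^ n - 1"
    using expansion_less[OF \<nu> f n k funpow_n_cycles_in[OF \<nu> i, of 1]] by simp
  then show "times_mod n k (expansion n k \<nu> f i) = expansion n k \<nu> f (\<nu> i)"
    unfolding times_mod_def expansion_step_minus1[OF \<nu> i k]
    by (simp only: mod_mult_self4 mod_less)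
  show "k * expansion n k \<nu> f i div (k ^ n - 1) = f i"
    unfolding expansion_step_minus1[OF \<nu> i k]
    using less by simp
qed

lemma funpow_times_mod_expansion:
  assumes \<nu>: "\<nu> \<in> n_cycles n" and f: "f \<in> labellings n k (descents n \<nu>)"
    and n: "n \<ge> 2" and k: "k \<ge> 2" and i: "i \<in> {1..n}"
  shows "(times_mod n k ^^ t) (expansion n k \<nu> f i) = expansion n k \<nu> f ((\<nu> ^^ t) i)"
proof (induction t)
  case (Suc t)
  then show ?case
    using times_mod_expansion(1)[OF \<nu> f n k funpow_n_cycles_in[OF \<nu> i, of t]] by simp
qed simp

lemma expansion_in_exact_period_points:
  assumes \<nu>: "\<nu> \<in> n_cycles n" and f: "f \<in> labellings n k (descents n \<nu>)"
    and n: "n \<ge> 2" and k: "k \<ge> 2" and i: "i \<in> {1..n}"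
  shows "expansion n k \<nu> f i \<in> exact_period_points n k"
proof -
  have "(times_mod n k ^^ r) (expansion n k \<nu> f i) \<noteq> expansion n k \<nu> f i"
    if r: "0 < r" "r < n" for r
  proof -
    have "(\<nu> ^^ r) i \<noteq> (\<nu> ^^ 0) i"
      using inj_onD[OF n_cycles_funpow(2)[OF \<nu> i], of r 0] r by auto
    then have "(\<nu> ^^ r) i \<noteq> i" by simp
    then show ?thesis
      unfolding funpow_times_mod_expansion[OF \<nu> f n k i]
      using strict_mono_on_imp_inj_on[OF expansion_strict_mono[OF \<nu> f n k]]
        funpow_n_cycles_in[OF \<nu> i] i by (auto dest: inj_onD)
  qed
  then show ?thesis
    using expansion_less[OF \<nu> f n k i] by (auto simp: exact_period_points_def)
qed

text \<open>
  A strictly increasing enumeration is determined by its image, because the index of a value is its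
  rank in the image.
\<close>

lemma strict_mono_on_same_image_eq:
  fixes g h :: "nat \<Rightarrow> nat"
  assumes g: "strict_mono_on {1..n} g" and h: "strict_mono_on {1..n} h"
    and im: "g ` {1..n} = h ` {1..n}" and i: "i \<in> {1..n}"
  shows "g i = h i"
proof -
  have rank: "card {y \<in> e ` {1..n}. y \<le> e j} = j"
    if e: "strict_mono_on {1..n} e" and j: "j \<in> {1..n}" for e :: "nat \<Rightarrow> nat" and j
  proof -
    have "e m \<le> e j \<longleftrightarrow> m \<le> j" if "m \<in> {1..n}" for m
      using strict_mono_on_less_eq[OF e that j] .
    then have "{y \<in> e ` {1..n}. y \<le> e j} = e ` {1..j}" using j by force
    moreover have "inj_on e {1..j}"
      using strict_mono_on_imp_inj_on[OF e] j by (auto intro: inj_on_subset)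
    ultimately show ?thesis by (simp add: card_image)
  qed
  obtain j where j: "j \<in> {1..n}" "g i = h j" using im i by blast
  then have "i = j" using rank[OF g i] rank[OF h j(1)] im by simp
  then show ?thesis using j by simp
qed

text \<open>
  The set of all expansions is the orbit of a single one under \<open>times_mod\<close>. So one expansion determines
  this set, then its increasing enumeration, then the action of \<open>\<nu>\<close> on the indices (multiplication
  modulo \<open>k ^ n - 1\<close>) and the labels (the quotients).
\<close>

lemma expansion_inj:
  assumes \<nu>: "\<nu> \<in> n_cycles n" and f: "f \<in> labellings n k (descents n \<nu>)" and i: "i \<in> {1..n}"
    and \<mu>: "\<mu> \<in> n_cycles n" and g: "g \<in> labellings n k (descents n \<mu>)" and j: "j \<in> {1..n}"
    and n: "n \<ge> 2" and k: "k \<ge> 2"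
    and eq: "expansion n k \<nu> f i = expansion n k \<mu> g j"
  shows "\<nu> = \<mu> \<and> f = g \<and> i = j"
proof -
  let ?X = "expansion n k \<nu> f" and ?Y = "expansion n k \<mu> g"
  note X_mono = expansion_strict_mono[OF \<nu> f n k]
  note Y_mono = expansion_strict_mono[OF \<mu> g n k]
  have "?X ` {1..n} = (\<lambda>t. (times_mod n k ^^ t) (?X i)) ` {0..<n}"
    unfolding funpow_times_mod_expansion[OF \<nu> f n k i]
    by (simp only: n_cycles_funpow(3)[OF \<nu> i, symmetric] image_image)
  also have "\<dots> = ?Y ` {1..n}"
    unfolding eq funpow_times_mod_expansion[OF \<mu> g n k j]
    by (simp only: n_cycles_funpow(3)[OF \<mu> j, symmetric] image_image)
  finally have XY: "?X m = ?Y m" if "m \<in> {1..n}" for m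
    using strict_mono_on_same_image_eq[OF X_mono Y_mono] that by blast
  have inj: "inj_on ?Y {1..n}" by (rule strict_mono_on_imp_inj_on[OF Y_mono])
  have "i = j" using inj_onD[OF inj _ i j] eq XY[OF i] by simp
  moreover have "\<nu> m = \<mu> m" for m
  proof (cases "m \<in> {1..n}")
    case True
    have in_range: "\<nu> m \<in> {1..n}" "\<mu> m \<in> {1..n}"
      using funpow_n_cycles_in[OF \<nu> True, of 1] funpow_n_cycles_in[OF \<mu> True, of 1] by simp_all
    have "?Y (\<nu> m) = times_mod n k (?X m)"
      unfolding times_mod_expansion(1)[OF \<nu> f n k True] by (rule XY[OF in_range(1), symmetric])
    also have "\<dots> = ?Y (\<mu> m)"
      unfolding XY[OF True] by (rule times_mod_expansion(1)[OF \<mu> g n k True])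
    finally show ?thesis by (rule inj_onD[OF inj _ in_range])
  next
    case False
    then show ?thesis
      using \<nu> \<mu> permutes_not_in[of \<nu> "{1..n}" m] permutes_not_in[of \<mu> "{1..n}" m]
      by (simp add: n_cycles_def)
  qed
  moreover have "f m = g m" for m
  proof (cases "m \<in> {1..n}")
    case True
    show ?thesis
      unfolding times_mod_expansion(2)[OF \<nu> f n k True, symmetric] XY[OF True]
      by (rule times_mod_expansion(2)[OF \<mu> g n k True])
  next
    case False
    then show ?thesis using f g unfolding labellings_def by (auto simp: PiE_iff extensional_def)
  qed
  ultimately show ?thesis by auto
qed

text \<open>
  Enumerate the orbit of \<open>x\<close> increasingly by \<open>e\<close>, let \<open>\<nu>\<close> be the permutation of the indices induced by
  \<open>times_mod\<close>, and let the labels be the leading digits \<open>k * e i div M\<close>. At a descent the remainder drops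
  although the argument grows, so the quotient has to grow.
\<close>

lemma exact_period_point_is_expansion:
  assumes n: "n \<ge> 2" and k: "k \<ge> 2" and x: "x \<in> exact_period_points n k"
  shows "\<exists>\<nu>\<in>n_cycles n. \<exists>f\<in>labellings n k (descents n \<nu>). \<exists>i\<in>{1..n}. x = expansion n k \<nu> f i"
proof -
  define M where "M = k ^ n - 1"
  let ?T = "times_mod n k"
  have xM: "x < M" and exact: "\<And>r. 0 < r \<Longrightarrow> r < n \<Longrightarrow> (?T ^^ r) x \<noteq> x"
    using x by (auto simp: exact_period_points_def M_def)
  have M0: "M > 0" using xM by simp
  define Orb where "Orb = orbit ?T x"
  have per: "(?T ^^ n) y = y" if "y < M" for y
    using funpow_times_mod_period that by (simp add: M_def)
  have x_self: "x \<in> orbit ?T x"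
    unfolding orbit_altdef using per[OF xM] n by (intro CollectI exI[of _ n]) simp
  have Orb_eq: "Orb = (\<lambda>t. (?T ^^ t) x) ` {0..<funpow_dist1 ?T x x}"
    unfolding Orb_def by (rule orbit_conv_funpow_dist1[OF x_self])
  have D: "funpow_dist1 ?T x x = n"
  proof (rule antisym)
    show "funpow_dist1 ?T x x \<le> n"
      using funpow_dist1_le_self[OF per[OF xM] _ x_self] n by simp
    show "n \<le> funpow_dist1 ?T x x"
      using exact[of "funpow_dist1 ?T x x"] funpow_dist1_prop[OF x_self] by (meson not_le zero_less_Suc)
  qed
  have card_O: "card Orb = n"
    using card_image[OF inj_on_funpow_dist1[OF x_self]] unfolding Orb_eq D by simp
  have fin_O: "finite Orb" unfolding Orb_eq by simp
  have O_less: "y < M" if "y \<in> Orb" for y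
    using that M0 unfolding Orb_def
    by (induction rule: orbit.induct) (auto simp: times_mod_def M_def)
  have T_O: "?T y \<in> Orb" if "y \<in> Orb" for y using that unfolding Orb_def by (rule orbit.step)
  have T_inj: "y = z" if "y \<in> Orb" "z \<in> Orb" "?T y = ?T z" for y z
  proof -
    have "(?T ^^ n) y = (?T ^^ n) z"
      using that(3) n by (cases n) (simp_all add: funpow_Suc_right del: funpow.simps)
    then show ?thesis using per O_less that by simp
  qed
  have cyc: "cyclic_on ?T Orb"
    unfolding cyclic_on_def Orb_def using x_self by blast
  obtain h where h: "bij_betw h {..<n} Orb" "strict_mono_on {..<n} h"
    using ex_bij_betw_strict_mono_card[OF fin_O] unfolding card_O by blast
  define e where "e i = h (i - 1)" for i
  have e_mono: "strict_mono_on {1..n} e"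
  proof (rule strict_mono_onI)
    fix i j assume "i \<in> {1..n}" "j \<in> {1..n}" "i < j"
    then show "e i < e j" unfolding e_def by (intro strict_mono_onD[OF h(2)]) auto
  qed
  have "(\<lambda>i. i - 1) ` {1..n} = {..<n}"
  proof (intro set_eqI iffI)
    fix i assume "i \<in> {..<n}"
    then show "i \<in> (\<lambda>i. i - 1) ` {1..n}" by (intro image_eqI[of _ _ "Suc i"]) auto
  qed auto
  then have e_im: "e ` {1..n} = Orb"
    using h(1) unfolding bij_betw_def e_def by (metis image_image)
  have e_inj: "inj_on e {1..n}" using e_mono by (rule strict_mono_on_imp_inj_on)
  have e_in: "e i \<in> Orb" if "i \<in> {1..n}" for i using e_im that by blast
  let ?e' = "inv_into {1..n} e"
  have e'_in: "?e' y \<in> {1..n}" and e_e': "e (?e' y) = y" if "y \<in> Orb" for y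
    using that e_im inv_into_into[of y e "{1..n}"] f_inv_into_f[of y e "{1..n}"] by simp_all
  have e'_e: "?e' (e i) = i" if "i \<in> {1..n}" for i using e_inj that by (rule inv_into_f_f)
  define \<nu> where "\<nu> i = (if i \<in> {1..n} then ?e' (?T (e i)) else i)" for i
  have \<nu>_in: "\<nu> i \<in> {1..n}" and e_\<nu>: "e (\<nu> i) = ?T (e i)" if "i \<in> {1..n}" for i
    using e'_in[OF T_O[OF e_in[OF that]]] e_e'[OF T_O[OF e_in[OF that]]] that
    by (simp_all only: \<nu>_def if_True)
  have "\<nu> permutes {1..n}"
  proof (rule bij_imp_permutes)
    have inj: "inj_on \<nu> {1..n}"
    proof (rule inj_onI)
      fix i j assume ij: "i \<in> {1..n}" "j \<in> {1..n}" "\<nu> i = \<nu> j"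
      then have "?T (e i) = ?T (e j)" using e_\<nu> by metis
      then have "e i = e j" using T_inj e_in ij by blast
      then show "i = j" using inj_onD[OF e_inj] ij by blast
    qed
    have "\<nu> ` {1..n} \<subseteq> {1..n}" using \<nu>_in by blast
    then have "\<nu> ` {1..n} = {1..n}" using inj by (intro endo_inj_surj) simp_all
    then show "bij_betw \<nu> {1..n} {1..n}" using inj unfolding bij_betw_def by blast
    show "\<nu> i = i" if "i \<notin> {1..n}" for i using that unfolding \<nu>_def by (rule if_not_P)
  qed
  moreover have "cyclic_on \<nu> {1..n}"
  proof -
    have "cyclic_on \<nu> (?e' ` Orb)"
    proof (rule cyclic_on_image[OF cyc])
      fix y assume y: "y \<in> Orb"
      show "\<nu> (?e' y) = ?e' (?T y)" using e'_in[OF y] e_e'[OF y] by (simp only: \<nu>_def if_True)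
    qed
    moreover have "?e' ` Orb = {1..n}"
      unfolding e_im[symmetric] using e'_e by (simp add: image_image)
    ultimately show ?thesis by simp
  qed
  ultimately have \<nu>: "\<nu> \<in> n_cycles n" by (simp add: n_cycles_def)
  define f where "f = restrict (\<lambda>i. k * e i div M) {1..n}"
  have f_eq: "k * e i = M * f i + e (\<nu> i)" if "i \<in> {1..n}" for i
  proof -
    have "f i = k * e i div M" using that unfolding f_def by (rule restrict_apply')
    moreover have "e (\<nu> i) = k * e i mod M"
      using e_\<nu>[OF that] by (simp add: times_mod_def M_def)
    ultimately show ?thesis by simp
  qed
  have f: "f \<in> labellings n k (descents n \<nu>)"
    unfolding labellings_def
  proof (intro CollectI conjI ballI PiE_I)
    fix i assume i: "i \<in> {1..n}"
    have "M * f i \<le> k * e i" unfolding f_eq[OF i] by simp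
    also have "\<dots> < k * M" using O_less[OF e_in[OF i]] k by simp
    finally have "M * f i < M * k" by (simp only: mult.commute)
    then show "f i \<in> {..<k}" by simp
  next
    fix i assume "i \<notin> {1..n}"
    then show "f i = undefined" unfolding f_def restrict_def by (rule if_not_P)
  next
    fix i assume "i \<in> {1..<n}"
    then have i: "i \<in> {1..n}" "Suc i \<in> {1..n}" by auto
    have less: "k * e i < k * e (Suc i)"
      using strict_mono_onD[OF e_mono i] k by simp
    have "f i = k * e i div M" "f (Suc i) = k * e (Suc i) div M"
      using i unfolding f_def by (simp_all only: restrict_apply')
    then show le: "f i \<le> f (Suc i)" using less by (simp add: div_le_mono)
    show "i \<in> descents n \<nu> \<longrightarrow> f i < f (Suc i)"
    proof
      assume "i \<in> descents n \<nu>"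
      then have "\<nu> (Suc i) < \<nu> i" by (simp add: descents_def)
      then have "e (\<nu> (Suc i)) < e (\<nu> i)" by (rule strict_mono_onD[OF e_mono \<nu>_in[OF i(2)] \<nu>_in[OF i(1)]])
      then have "f i \<noteq> f (Suc i)" using less f_eq[OF i(1)] f_eq[OF i(2)] by auto
      then show "f i < f (Suc i)" using le by simp
    qed
  qed
  \<comment> \<open>Both sides solve the same recursion, so their difference is multiplied by \<open>k\<close> along \<open>\<nu>\<close>;
    going once around the cycle shows that it vanishes.\<close>
  have X_eq: "expansion n k \<nu> f i = e i" if i: "i \<in> {1..n}" for i
  proof -
    define \<delta> where "\<delta> j = int (expansion n k \<nu> f j) - int (e j)" for j
    have step: "int k * \<delta> j = \<delta> (\<nu> j)" if "j \<in> {1..n}" for j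
    proof -
      have "int (k * expansion n k \<nu> f j) - int (k * e j) =
          int (expansion n k \<nu> f (\<nu> j)) - int (e (\<nu> j))"
        unfolding expansion_step_minus1[OF \<nu> that k] f_eq[OF that] M_def by simp
      then show ?thesis by (simp add: \<delta>_def right_diff_distrib)
    qed
    have "int k ^ t * \<delta> i = \<delta> ((\<nu> ^^ t) i)" for t
    proof (induction t)
      case (Suc t)
      have "int k ^ Suc t * \<delta> i = int k * \<delta> ((\<nu> ^^ t) i)" using Suc by simp
      then show ?case using step[OF funpow_n_cycles_in[OF \<nu> i, of t]] by simp
    qed simp
    from this[of n] have "int k ^ n * \<delta> i = \<delta> i" by (simp only: n_cycles_funpow(1)[OF \<nu> i])
    moreover have "1 < int k ^ n" using k n by (intro one_less_power) auto
    ultimately have "\<delta> i = 0" by simp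
    then show ?thesis by (simp add: \<delta>_def)
  qed
  have "x \<in> Orb" using x_self by (simp add: Orb_def)
  then obtain i where "i \<in> {1..n}" "x = e i" using e_im by blast
  then show ?thesis using \<nu> f X_eq by metis
qed

lemma card_exact_period_points_eq_sum_labellings:
  assumes n: "n \<ge> 2" and k: "k \<ge> 2"
  shows "card (exact_period_points n k) =
    n * (\<Sum>\<nu>\<in>n_cycles n. (n + k - 1 - card (descents n \<nu>)) choose n)"
proof -
  define S where "S = (SIGMA \<nu>:n_cycles n. labellings n k (descents n \<nu>) \<times> {1..n})"
  let ?\<Phi> = "\<lambda>(\<nu>, f, i). expansion n k \<nu> f i"
  have "bij_betw ?\<Phi> S (exact_period_points n k)"
    unfolding bij_betw_def
  proof
    show "inj_on ?\<Phi> S"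
    proof (rule inj_onI)
      fix a b assume ab: "a \<in> S" "b \<in> S" "?\<Phi> a = ?\<Phi> b"
      obtain \<nu> f i \<mu> g j where eqs: "a = (\<nu>, f, i)" "b = (\<mu>, g, j)" by (metis prod_cases3)
      have "\<nu> \<in> n_cycles n" "f \<in> labellings n k (descents n \<nu>)" "i \<in> {1..n}"
        "\<mu> \<in> n_cycles n" "g \<in> labellings n k (descents n \<mu>)" "j \<in> {1..n}"
        "expansion n k \<nu> f i = expansion n k \<mu> g j"
        using ab unfolding S_def eqs by simp_all
      from expansion_inj[OF this(1-6) n k this(7)] show "a = b" unfolding eqs by simp
    qed
    show "?\<Phi> ` S = exact_period_points n k"
    proof
      show "?\<Phi> ` S \<subseteq> exact_period_points n k"
      proof (rule image_subsetI)
        fix a assume a: "a \<in> S"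
        obtain \<nu> f i where eq: "a = (\<nu>, f, i)" by (metis prod_cases3)
        have "\<nu> \<in> n_cycles n" "f \<in> labellings n k (descents n \<nu>)" "i \<in> {1..n}"
          using a unfolding S_def eq by simp_all
        from expansion_in_exact_period_points[OF this(1,2) n k this(3)]
        show "?\<Phi> a \<in> exact_period_points n k" unfolding eq by simp
      qed
      show "exact_period_points n k \<subseteq> ?\<Phi> ` S"
      proof
        fix x assume "x \<in> exact_period_points n k"
        then obtain \<nu> f i where "\<nu> \<in> n_cycles n" "f \<in> labellings n k (descents n \<nu>)"
            "i \<in> {1..n}" "x = expansion n k \<nu> f i"
          using exact_period_point_is_expansion[OF n k] by blast
        then show "x \<in> ?\<Phi> ` S" unfolding S_def by (intro image_eqI[of _ _ "(\<nu>, f, i)"]) auto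
      qed
    qed
  qed
  then have "card (exact_period_points n k) = card S" by (simp add: bij_betw_same_card)
  also have "\<dots> = (\<Sum>\<nu>\<in>n_cycles n. card (labellings n k (descents n \<nu>)) * n)"
    unfolding S_def
    by (subst card_SigmaI) (simp_all add: finite_n_cycles finite_labellings card_cartesian_product)
  also have "\<dots> = (\<Sum>\<nu>\<in>n_cycles n. n * ((n + k - 1 - card (descents n \<nu>)) choose n))"
  proof (intro sum.cong refl)
    fix \<nu>
    have "descents n \<nu> \<inter> {1..<n} = descents n \<nu>" by (auto simp: descents_def)
    then show "card (labellings n k (descents n \<nu>)) * n =
        n * ((n + k - 1 - card (descents n \<nu>)) choose n)"
      by (simp only: card_labellings mult.commute)
  qed
  finally show ?thesis by (simp add: sum_distrib_left)
qed

section \<open>The coefficient identity and the range of the degree\<close>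

text \<open>
  Both sides, multiplied by \<open>k - 1\<close>, count the points of exact period \<open>n\<close>: one by Moebius inversion, the
  other by sorting orbits.
\<close>

lemma sum_binomial_perm_deg_eq_Delta_of_ge_2:
  assumes n: "n \<ge> 2" and k: "k \<ge> 2"
  shows "(\<Sum>\<nu>\<in>n_cycles n. int ((n - 1 + k - perm_deg n \<nu>) choose (n - 1))) = Delta n k"
    (is "?S = _")
proof -
  have "(int k - 1) * ?S =
      int n * (\<Sum>\<nu>\<in>n_cycles n. int ((n + k - 1 - card (descents n \<nu>)) choose n))"
    using sum_binomial_descents_eq_sum_binomial_perm_deg[OF n, of k] k by simp
  also have "\<dots> = int (card (exact_period_points n k))"
    unfolding card_exact_period_points_eq_sum_labellings[OF n k] by (simp only: of_nat_mult of_nat_sum)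
  also have "\<dots> = (int k - 1) * Delta n k"
    by (rule card_exact_period_points_eq_Delta) (use n k in auto)
  finally show ?thesis using k by simp
qed

lemma binomial_shift_is_poly:
  "\<exists>p :: real poly. \<forall>k. d \<le> c + k \<longrightarrow> poly p (real k) = real ((c + k - d) choose m)"
proof -
  define p :: "real poly" where
    "p = smult (1 / fact m) (\<Prod>i=0..<m. [:real c - real d - real i, 1:])"
  have "poly p (real k) = real ((c + k - d) choose m)" if "d \<le> c + k" for k
  proof -
    have "poly p (real k) = (\<Prod>i=0..<m. (real c - real d - real i) + real k) / fact m"
      by (simp add: p_def poly_prod)
    also have "\<dots> = (\<Prod>i=0..<m. real (c + k - d) - real i) / fact m"
      using that by (intro arg_cong2[of _ _ _ _ "(/)"] prod.cong refl) (simp add: of_nat_diff)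
    also have "\<dots> = real (c + k - d) gchoose m" by (rule gbinomial_prod_rev[symmetric])
    finally show ?thesis by (simp add: binomial_gbinomial)
  qed
  then show ?thesis by blast
qed

lemma poly_eqI_of_nat:
  fixes p q :: "real poly"
  assumes "\<And>k. k \<ge> a \<Longrightarrow> poly p (real k) = poly q (real k)"
  shows "p = q"
proof (rule ccontr)
  assume "p \<noteq> q"
  then have "finite {x. poly (p - q) x = 0}" by (intro poly_roots_finite) simp
  moreover have "real ` {a..} \<subseteq> {x. poly (p - q) x = 0}" using assms by auto
  ultimately have "finite (real ` {a..})" by (rule rev_finite_subset)
  then show False using finite_imageD[of real "{a..}"] by (simp add: infinite_Ici)
qed

text \<open>
  For \<open>k = 1\<close> the circle map is the identity and the factor \<open>k - 1\<close> cannot be cancelled. But both sides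
  are values at \<open>k\<close> of polynomials, which agree at all \<open>k \<ge> 2\<close>.
\<close>

lemma sum_binomial_perm_deg_eq_Delta:
  assumes n: "n \<ge> 2" and k: "k \<ge> 1"
  shows "(\<Sum>\<nu>\<in>n_cycles n. int ((n - 1 + k - perm_deg n \<nu>) choose (n - 1))) = Delta n k"
proof -
  obtain b :: "nat \<Rightarrow> real poly" where
    b: "\<And>d k. d \<le> n - 1 + k \<Longrightarrow> poly (b d) (real k) = real ((n - 1 + k - d) choose (n - 1))"
    using binomial_shift_is_poly[of _ "n - 1" "n - 1"] by metis
  define p where "p = (\<Sum>\<nu>\<in>n_cycles n. b (perm_deg n \<nu>))"
  define q :: "real poly" where
    "q = (\<Sum>r | r dvd n. smult (of_int (moebius_mu (n div r))) (\<Sum>j<r. monom 1 j))"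
  have p: "poly p (real k) =
      real_of_int (\<Sum>\<nu>\<in>n_cycles n. int ((n - 1 + k - perm_deg n \<nu>) choose (n - 1)))"
    if "k \<ge> 1" for k
  proof -
    have "perm_deg n \<nu> \<le> n - 1 + k" for \<nu> using perm_deg_le[of n \<nu>] that by simp
    then show ?thesis by (simp add: p_def poly_sum b)
  qed
  have q: "poly q (real k) = real_of_int (Delta n k)" for k
    by (simp add: q_def poly_sum poly_monom Delta_def)
  have "p = q"
  proof (rule poly_eqI_of_nat[of 2])
    fix k :: nat assume k: "k \<ge> 2"
    then have "k \<ge> 1" by simp
    then show "poly p (real k) = poly q (real k)"
      by (simp only: p q sum_binomial_perm_deg_eq_Delta_of_ge_2[OF n k])
  qed
  then have "real_of_int (\<Sum>\<nu>\<in>n_cycles n. int ((n - 1 + k - perm_deg n \<nu>) choose (n - 1))) =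
      real_of_int (Delta n k)"
    unfolding p[OF k, symmetric] q[symmetric] by simp
  then show ?thesis by (simp only: of_int_eq_iff)
qed

lemma perm_deg_pos:
  assumes "\<nu> \<in> n_cycles n" "n \<ge> 2"
  shows "perm_deg n \<nu> \<ge> 1"
  using card_rotations_with_wrap_descent[OF assms] by linarith

text \<open>
  All arcs have length at most \<open>n - 1\<close>, so a degree of at least \<open>n - 1\<close> forces every arc to have this
  length. Then \<open>\<nu> i + i\<close> is constant modulo \<open>n\<close>: \<open>\<nu>\<close> is a reflection, hence an involution, and not
  an \<open>n\<close>-cycle for \<open>n \<ge> 3\<close>.
\<close>

lemma perm_deg_le_minus_2:
  assumes \<nu>: "\<nu> \<in> n_cycles n" and n: "n \<ge> 3"
  shows "perm_deg n \<nu> \<le> n - 2"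
proof (rule ccontr)
  assume "\<not> ?thesis"
  then have deg: "int (perm_deg n \<nu>) \<ge> int n - 1" using n by linarith
  let ?s = "cyc_succ n"
  have perm: "\<nu> permutes {1..n}" using \<nu> by (simp add: n_cycles_def)
  have gap_le: "gap n \<nu> i \<le> int n - 1" for i
    using pos_mod_bound[of "int n" "int (\<nu> (?s i)) - int (\<nu> i)"] n unfolding gap_def by linarith
  have gap_eq: "gap n \<nu> i = int n - 1" if i: "i \<in> {1..n}" for i
  proof (rule ccontr)
    assume "gap n \<nu> i \<noteq> int n - 1"
    then have "gap n \<nu> i < int n - 1" using gap_le[of i] by linarith
    then have "(\<Sum>i=1..n. gap n \<nu> i) < (\<Sum>i=1..n. int n - 1)"
      using i gap_le by (intro sum_strict_mono_ex1) auto
    then have "int n * int (perm_deg n \<nu>) < int n * (int n - 1)"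
      unfolding sum_gap_eq_perm_deg[OF perm] by simp
    then show False using deg n by simp
  qed
  have const_step: "(int (\<nu> (?s i)) + int (?s i)) mod int n = (int (\<nu> i) + int i) mod int n"
    if i: "i \<in> {1..n}" for i
  proof -
    have "(int (\<nu> i) + gap n \<nu> i) mod int n = int (\<nu> (?s i)) mod int n"
      by (simp add: gap_def mod_simps)
    then have "(int (\<nu> (?s i)) + int (?s i)) mod int n =
        ((int (\<nu> i) + (int n - 1)) mod int n + (int i + 1) mod int n) mod int n"
      unfolding gap_eq[OF i] cyc_succ_cong[OF i, symmetric] by (simp add: mod_simps)
    also have "\<dots> = ((int (\<nu> i) + (int n - 1)) + (int i + 1)) mod int n" by (rule mod_add_eq)
    also have "(int (\<nu> i) + (int n - 1)) + (int i + 1) = int (\<nu> i) + int i + int n" by simp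
    finally show ?thesis by simp
  qed
  have s_pow_in: "(?s ^^ t) n \<in> {1..n}" for t
  proof (induction t)
    case (Suc t)
    then show ?case using permutes_in_image[OF cyc_succ_permutes, of n "(?s ^^ t) n"] by simp
  qed (use n in simp)
  have "(int (\<nu> ((?s ^^ t) n)) + int ((?s ^^ t) n)) mod int n = (int (\<nu> n) + int n) mod int n" for t
    by (induction t) (simp_all only: funpow.simps o_apply id_apply const_step[OF s_pow_in])
  then have const: "(int (\<nu> i) + int i) mod int n = (int (\<nu> n) + int n) mod int n"
    if "i \<in> {1..n}" for i
    using cyc_succ_funpow_last[OF that] by metis
  have one: "1 \<in> {1..n}" using n by simp
  have in_range: "\<nu> 1 \<in> {1..n}" "\<nu> (\<nu> 1) \<in> {1..n}"
    using funpow_n_cycles_in[OF \<nu> one, of 1] funpow_n_cycles_in[OF \<nu> one, of 2]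
    by (simp_all add: numeral_2_eq_2)
  have "(int (\<nu> (\<nu> 1)) + int (\<nu> 1)) mod int n = (int (\<nu> 1) + int 1) mod int n"
    using const[OF one] const[OF in_range(1)] by simp
  then have "(int (\<nu> (\<nu> 1)) - 1) mod int n = 0"
    by (simp add: mod_eq_dvd_iff)
  moreover have "(int (\<nu> (\<nu> 1)) - 1) mod int n = int (\<nu> (\<nu> 1)) - 1"
    using in_range(2) by (intro mod_pos_pos_trivial) auto
  ultimately have "(\<nu> ^^ 2) 1 = (\<nu> ^^ 0) 1" by (simp add: numeral_2_eq_2)
  then show False
    using inj_onD[OF n_cycles_funpow(2)[OF \<nu> one], of 2 0] n by simp
qed

section \<open>The generating function\<close>

lemma one_minus_X_power_mult_binomial_series:
  "(1 - fps_X) ^ Suc m * Abs_fps (\<lambda>i. int ((m + i) choose m)) = 1"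
proof -
  have nth: "fps_nth ((1 - fps_X) * F) i = fps_nth F i - (if i = 0 then 0 else fps_nth F (i - 1))"
    for F :: "int fps" and i
    by (simp add: left_diff_distrib)
  show ?thesis
  proof (induction m)
    case 0
    show ?case by (rule fps_ext) (simp add: nth)
  next
    case (Suc m)
    have "(1 - fps_X) * Abs_fps (\<lambda>i. int ((Suc m + i) choose Suc m)) =
        Abs_fps (\<lambda>i. int ((m + i) choose m))"
    proof (rule fps_ext)
      fix i
      show "fps_nth ((1 - fps_X) * Abs_fps (\<lambda>i. int ((Suc m + i) choose Suc m))) i =
          fps_nth (Abs_fps (\<lambda>i. int ((m + i) choose m))) i"
        by (cases i) (simp_all add: nth)
    qed
    then have "(1 - fps_X) ^ Suc (Suc m) * Abs_fps (\<lambda>i. int ((Suc m + i) choose Suc m)) =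
        (1 - fps_X) ^ Suc m * Abs_fps (\<lambda>i. int ((m + i) choose m))"
      by (simp only: power_Suc2[of _ "Suc m"] mult.assoc)
    then show ?case unfolding Suc.IH .
  qed
qed

lemma deg_gen_fun_eq_sum_n_cycles:
  assumes n: "n \<ge> 3"
  shows "deg_gen_fun n = (\<Sum>\<nu>\<in>n_cycles n. fps_X ^ perm_deg n \<nu>)"
proof -
  have range: "perm_deg n ` n_cycles n \<subseteq> {1..n-2}"
  proof (intro image_subsetI)
    fix \<nu> assume \<nu>: "\<nu> \<in> n_cycles n"
    show "perm_deg n \<nu> \<in> {1..n-2}"
      using perm_deg_pos[OF \<nu>] perm_deg_le_minus_2[OF \<nu> n] n by simp
  qed
  have "(\<Sum>\<nu>\<in>n_cycles n. fps_X ^ perm_deg n \<nu>) =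
      (\<Sum>d=1..n-2. \<Sum>\<nu> | \<nu> \<in> n_cycles n \<and> perm_deg n \<nu> = d. fps_X ^ perm_deg n \<nu> :: int fps)"
    by (rule sum.group[symmetric, OF finite_n_cycles _ range]) simp
  also have "\<dots> = (\<Sum>d=1..n-2. fps_const (int (num_cycles_deg n d)) * fps_X ^ d)"
    by (intro sum.cong refl) (simp add: num_cycles_deg_def fps_of_nat)
  finally show ?thesis by (simp add: deg_gen_fun_def)
qed

theorem theorem4p7:
  fixes n :: nat
  assumes "n \<ge> 3"
  shows "deg_gen_fun n =
    (1 - fps_X) ^ n * Abs_fps (\<lambda>i. if i \<ge> 1 then Delta n i else 0)"
proof -
  define B where "B = Abs_fps (\<lambda>i. int ((n - 1 + i) choose (n - 1)))"
  have n2: "n \<ge> 2" using assms by simp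
  have inverse: "(1 - fps_X) ^ n * B = 1"
    using one_minus_X_power_mult_binomial_series[of "n - 1"] assms by (simp add: B_def)
  have "deg_gen_fun n * B = Abs_fps (\<lambda>i. if i \<ge> 1 then Delta n i else 0)"
  proof (rule fps_ext)
    fix i
    have coeff: "fps_nth (fps_X ^ perm_deg n \<nu> * B) i = (if i \<ge> 1
        then int ((n - 1 + i - perm_deg n \<nu>) choose (n - 1)) else 0)"
      if \<nu>: "\<nu> \<in> n_cycles n" for \<nu>
    proof (cases "i < perm_deg n \<nu>")
      case True
      \<comment> \<open>Below the degree the truncated coefficient and the binomial coefficient both vanish.\<close>
      then have "n - 1 + i - perm_deg n \<nu> < n - 1" using assms by linarith
      then show ?thesis using True by (simp add: fps_X_power_mult_nth binomial_eq_0)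
    next
      case False
      then have "i \<ge> 1" "n - 1 + (i - perm_deg n \<nu>) = n - 1 + i - perm_deg n \<nu>"
        using perm_deg_pos[OF \<nu> n2] by auto
      then show ?thesis using False by (simp add: fps_X_power_mult_nth B_def)
    qed
    have "fps_nth (deg_gen_fun n * B) i =
        (\<Sum>\<nu>\<in>n_cycles n. fps_nth (fps_X ^ perm_deg n \<nu> * B) i)"
      by (simp add: deg_gen_fun_eq_sum_n_cycles[OF assms] sum_distrib_right fps_sum_nth)
    also have "\<dots> = (if i \<ge> 1 then Delta n i else 0)"
      using sum_binomial_perm_deg_eq_Delta[OF n2, of i] by (simp add: coeff)
    finally show "fps_nth (deg_gen_fun n * B) i =
        fps_nth (Abs_fps (\<lambda>i. if i \<ge> 1 then Delta n i else 0)) i" by simp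
  qed
  then have "(1 - fps_X) ^ n * Abs_fps (\<lambda>i. if i \<ge> 1 then Delta n i else 0) =
      deg_gen_fun n * ((1 - fps_X) ^ n * B)"
    by (metis mult.left_commute)
  then show ?thesis by (simp only: inverse mult_1_right)
qed

end
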